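(* Fix an integer $k\ge0$. Let $1<p<\infty$ and $r>1$. Let $w$ be a weight and $f$ a locally integrable function with $[w]_{A_p^r}<\infty$ and \[ \|f\|_{\mathrm{BMO}_k^r(w)}:=\sup_Q\frac1{w_r(Q)}\int_Q|f-P_Qf|<\infty. \] Then for every cube $Q$, \[ \left(\frac1{w_r(Q)}\int_Q\left|\frac{f(x)-P_Qf(x)}{w(x)}\right|^{p'}w(x)\,dx\right)^{1/p'}\le c_n\,\gamma\,p'\,[w]_{A_p^r}^{1/p}\,(r')^{1/p'}\,\|f\|_{\mathrm{BMO}_k^r(w)}, \] where $c_n$ depends only on $n$ and $\gamma$ is the constant (depending only on $n,k$) with $|P_Rg(x)|\le\gamma\frac1{|R|}\int_R|g|$ for all cubes $R$, $g\in L^1(R)$, $x\in R$.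
   Context: For a cube $R$, $P_R$ denotes the orthogonal projection, with respect to $\langle f,g\rangle_R=\frac1{|R|}\int_Rf\bar g$, onto polynomials of degree at most $k$ restricted to $R$, given by $P_Rf=\sum_j\langle f,e_{j,R}\rangle_Re_{j,R}$ for an orthonormal basis $\{e_{j,R}\}$ obtained by translating and dilating a fixed orthonormal basis for $[0,1]^n$; this defines $P_R$ on $L^1(R)$. $w_r(Q)=|Q|\left(\frac1{|Q|}\int_Qw^r\right)^{1/r}$; $p'=p/(p-1)$, $r'=r/(r-1)$; $[w]_{A_p^r}=\sup_Q\left(\frac1{|Q|}\int_Qw^r\right)^{1/r}\left(\frac1{|Q|}\int_Qw^{1-p'}\right)^{p-1}$. A weight is a non-negative locally integrable function. *)

theory Defs
  imports "HOL-Analysis.Analysis"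
begin

definition is_cube :: "(real^'n) set \<Rightarrow> bool" where
  "is_cube Q \<longleftrightarrow> (\<exists>a l. l > 0 \<and> Q = cbox a (a + l *\<^sub>R One))"

definition monom_n :: "('n::finite \<Rightarrow> nat) \<Rightarrow> real^'n \<Rightarrow> real" where
  "monom_n \<alpha> x = (\<Prod>i\<in>UNIV. (x $ i) ^ (\<alpha> i))"

definition multi_idx :: "nat \<Rightarrow> ('n::finite \<Rightarrow> nat) set" where
  "multi_idx k = {\<alpha>. sum \<alpha> UNIV \<le> k}"

definition polys_deg :: "nat \<Rightarrow> (real^'n::finite \<Rightarrow> complex) set" where
  "polys_deg k = {q. \<exists>c. q = (\<lambda>x. \<Sum>\<alpha>\<in>multi_idx k. c \<alpha> * complex_of_real (monom_n \<alpha> x))}"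

text \<open>Orthogonal projection P_Q onto polynomials of degree at most k w.r.t. the
  (normalised) L^2(Q) inner product: the unique polynomial q with f - q orthogonal
  to all polynomials of degree at most k.\<close>
definition proj_poly :: "nat \<Rightarrow> (real^'n::finite) set \<Rightarrow> (real^'n \<Rightarrow> complex) \<Rightarrow> (real^'n \<Rightarrow> complex)" where
  "proj_poly k Q f = (THE q. q \<in> polys_deg k \<and>
     (\<forall>\<alpha>\<in>multi_idx k. (LINT x:Q|lebesgue. (f x - q x) * complex_of_real (monom_n \<alpha> x)) = 0))"

definition avg :: "(real^'n::finite) set \<Rightarrow> (real^'n \<Rightarrow> real) \<Rightarrow> real" where
  "avg Q g = (LINT x:Q|lebesgue. g x) / measure lebesgue Q"

definition w_r :: "real \<Rightarrow> (real^'n::finite \<Rightarrow> real) \<Rightarrow> (real^'n) set \<Rightarrow> real" where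
  "w_r r w Q = measure lebesgue Q * (avg Q (\<lambda>x. w x powr r)) powr (1 / r)"

definition conj_exp :: "real \<Rightarrow> real" where
  "conj_exp p = p / (p - 1)"

definition Apr_set :: "real \<Rightarrow> real \<Rightarrow> (real^'n::finite \<Rightarrow> real) \<Rightarrow> real set" where
  "Apr_set p r w = {(avg Q (\<lambda>x. w x powr r)) powr (1 / r) *
                    (avg Q (\<lambda>x. w x powr (1 - conj_exp p))) powr (p - 1) | Q. is_cube Q}"

definition Apr_const :: "real \<Rightarrow> real \<Rightarrow> (real^'n::finite \<Rightarrow> real) \<Rightarrow> real" where
  "Apr_const p r w = Sup (Apr_set p r w)"

definition BMO_set :: "nat \<Rightarrow> real \<Rightarrow> (real^'n::finite \<Rightarrow> real) \<Rightarrow> (real^'n \<Rightarrow> complex) \<Rightarrow> real set" where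
  "BMO_set k r w f = {(1 / w_r r w Q) * (LINT x:Q|lebesgue. cmod (f x - proj_poly k Q f x)) | Q. is_cube Q}"

definition BMO_norm :: "nat \<Rightarrow> real \<Rightarrow> (real^'n::finite \<Rightarrow> real) \<Rightarrow> (real^'n \<Rightarrow> complex) \<Rightarrow> real" where
  "BMO_norm k r w f = Sup (BMO_set k r w f)"

definition locally_integrable :: "(real^'n::finite \<Rightarrow> 'b::{banach,second_countable_topology}) \<Rightarrow> bool" where
  "locally_integrable f \<longleftrightarrow> (\<forall>K. compact K \<longrightarrow> set_integrable lebesgue K f)"

end

theory Submission
  imports Defs "HOL-Computational_Algebra.Polynomial"
begin

text \<open>
  Write $q = p'$, $\sigma = w^{1-q}$, $F_R = |f - P_R f|$ and let $a_R$ be the $L^r$ average of $w$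
  over $R$, so that the average of $F_R$ over $R$ is at most $N a_R$ with $N$ the BMO norm, and
  the left-hand side is $\int_Q F_Q^q \sigma$ divided by $w_r(Q) = |Q| a_Q$.
  A Calderon--Zygmund decomposition of $F_R$ at twice its average gives disjoint subcubes $D$ of $R$
  of total measure at most $|R|/2$ with $F_R \le \alpha_R$ off these cubes and
  $F_R \le \alpha_R + F_D$ on each $D$, where $\alpha_R = 2^{n+1} \gamma N a_R$; here
  $P_D(f - P_R f) = P_D f - P_R f$ is used.

  Since $x \le \alpha + T$ implies $x^s \le T^s + \max(1,s)\, \alpha^t x^{s-t}$ for $t \le 1$, the
  integrals $J_s(R) = \int_R F_R^s \sigma$ obey
  $J_s(R) \le \sum_D J_s(D) + \max(1,s)\, \alpha_R^t J_{s-t}(R)$. One climbs from $s = 0$ to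
  $s = q - 1$ in $L = \lceil q - 1 \rceil$ equal steps, with
  $J_{it}(R) \le C_i |R|^{i/L} \sigma(R)^{1-i/L}$ for $t = (q-1)/L$: each step
  spends one factor $a_R (\sigma(R)/|R|)^{p-1} \le [w]$, and the sum over the children
  contracts by $2^{-i/L}$ because $\sum_D |D| \le |R|/2$. The last step, of length 1, ends at
  $|R|\, a_R$ and contracts by $2^{-1/r'}$, which produces the factor $r'$.
\<close>

section \<open>Powers\<close>

text \<open>The recursion for \<open>J_s\<close> keeps the exponent s on the children, and no
  \<open>J_s(R)\<close> is known to be finite beforehand. Hence bounds \<open>B i R\<close> are
  fixed in advance and the recursion is unrolled finitely often: one checks that the children use at
  most a share \<open>\<rho>\<close> of \<open>B\<close> and that the error term fits into the
  remaining share \<open>1 - \<rho>\<close>.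

  The ladder rests on (p - 1)(p' - 1) = 1: a step of length (q - 1)/L trades exactly
  \<sigma>(R)^(1/L) for |R|^(1/L), so \<sigma> is used up after L steps. The total power of [w] is
  then q - 1, and its q-th root is [w]^(1/p).

  The last step contracts because |R| a_R is |R|^(1/r') times the (1/r)-th power of the integral of
  w^r, again a product to which Hoelder's inequality for sums applies. For r = 1 it would merely be
  additive over the subcubes, with no gain; this is why the constant grows with r'.

  Linear growth in p' comes from a cancellation: the step to i costs at most i and gains at least
  i/(2L), a quotient of 2L whatever i is. The product (2L)^L is at most (2q)^q, whose q-th root is
  linear in q.\<close>

lemma powr_mult_le_convex:
  fixes x y \<theta> :: real
  assumes "0 \<le> x" "0 \<le> y" "0 \<le> \<theta>" "\<theta> \<le> 1"
  shows "x powr (1 - \<theta>) * y powr \<theta> \<le> (1 - \<theta>) * x + \<theta> * y"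
proof (cases "x = 0 \<or> y = 0")
  case True
  then show ?thesis using assms by auto
next
  case False
  then show ?thesis using assms by (intro Youngs_inequality_0) auto
qed

text \<open>After dividing by \<open>x\<close>, with u = T/x, Bernoulli's inequality gives 1 - u^s
  \<le> max(1,s) (1 - u), and 1 - u \<le> (1 - u)^t because t \<le> 1; finally x^t (1 - u)^t = (x -
  T)^t \<le> \<alpha>^t. The coefficient of \<open>T powr s\<close> has to be exactly 1: a larger
  one could destroy the contraction over the subcubes, whose factors may be close to 1.\<close>

lemma powr_le_step:
  fixes x T \<alpha> s t :: real
  assumes "0 \<le> x" "0 \<le> T" "0 \<le> \<alpha>" "x \<le> \<alpha> + T" "0 < t" "t \<le> 1" "t \<le> s"
  shows "x powr s \<le> T powr s + max 1 s * \<alpha> powr t * x powr (s - t)"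
proof (cases "x \<le> T")
  case True
  then have "x powr s \<le> T powr s" using assms by (intro powr_mono2) auto
  moreover have "0 \<le> max 1 s * \<alpha> powr t * x powr (s - t)" by (intro mult_nonneg_nonneg) auto
  ultimately show ?thesis by linarith
next
  case False
  then have x: "x > 0" "T < x" using assms by auto
  define u where "u = T / x"
  have u: "0 \<le> u" "u < 1" using x assms by (auto simp: u_def)
  have T: "T = u * x" using x by (simp add: u_def)
  have A: "1 - u powr s \<le> max 1 s * (1 - u)"
  proof (cases "s \<ge> 1")
    case True
    show ?thesis
    proof -
      \<comment> \<open>Bernoulli's inequality for a real exponent, read off from the weighted mean
        of 1 and \<open>u powr s\<close> with weight 1/s on the latter.\<close>
      have "1 powr (1 - 1 / s) * (u powr s) powr (1 / s) \<le> (1 - 1 / s) * 1 + (1 / s) * u powr s"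
        using u True by (intro powr_mult_le_convex) auto
      moreover have "(u powr s) powr (1 / s) = u" using u True by (simp add: powr_powr)
      ultimately have "u \<le> (1 - 1 / s) + (1 / s) * u powr s" by simp
      then have "s * u \<le> s * ((1 - 1 / s) + (1 / s) * u powr s)"
        using True by (intro mult_left_mono) auto
      also have "\<dots> = s - 1 + u powr s" using True by (simp add: algebra_simps)
      finally show ?thesis using True by (simp add: algebra_simps)
    qed
  next
    case False
    have "u powr 1 \<le> u powr s"
    proof (cases "u = 0")
      case False
      then show ?thesis using u \<open>\<not> 1 \<le> s\<close> by (intro powr_mono') auto
    qed auto
    then show ?thesis using False u by simp
  qed
  have B: "(1 - u) \<le> (1 - u) powr t"
  proof -
    have "(1 - u) powr 1 \<le> (1 - u) powr t" using u assms by (intro powr_mono') auto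
    then show ?thesis using u by simp
  qed
  have C: "(1 - u) powr t * x powr t \<le> \<alpha> powr t"
  proof -
    have "(1 - u) powr t * x powr t = ((1 - u) * x) powr t" using u x by (simp add: powr_mult)
    also have "\<dots> \<le> \<alpha> powr t"
      using assms T u x by (intro powr_mono2) (auto simp: algebra_simps)
    finally show ?thesis .
  qed
  have "x powr s = x powr s * u powr s + x powr s * (1 - u powr s)" by (simp add: algebra_simps)
  also have "x powr s * u powr s = T powr s" using u x by (simp add: T powr_mult mult.commute)
  also have "x powr s * (1 - u powr s) \<le> x powr s * (max 1 s * (1 - u) powr t)"
  proof (intro mult_left_mono)
    have "max 1 s * (1 - u) \<le> max 1 s * (1 - u) powr t" using B by (intro mult_left_mono) auto
    with A show "1 - u powr s \<le> max 1 s * (1 - u) powr t" by linarith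
  qed auto
  also have "x powr s * (max 1 s * (1 - u) powr t)
      = max 1 s * x powr (s - t) * ((1 - u) powr t * x powr t)"
  proof -
    have "x powr s = x powr (s - t) * x powr t" by (simp add: powr_add[symmetric])
    then show ?thesis by (simp only: mult_ac)
  qed
  also have "\<dots> \<le> max 1 s * x powr (s - t) * \<alpha> powr t" using C by (intro mult_left_mono) auto
  also have "\<dots> = max 1 s * \<alpha> powr t * x powr (s - t)" by (simp only: mult_ac)
  finally show ?thesis by simp
qed

text \<open>The convex function 2^(-x) lies below its chord over [0,1]. This bounds the gain
  \<open>1 - \<rho>\<close> of a step from below: x = i/L on the ladder, x = 1/r' at the
  end.\<close>

lemma two_powr_minus_le:
  fixes x :: real
  assumes "0 \<le> x" "x \<le> 1"
  shows "x / 2 \<le> 1 - 2 powr (- x)"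
proof -
  have "2 powr (- x) = 1 powr (1 - x) * (1 / 2) powr x" by (simp add: powr_divide powr_minus_divide)
  also have "\<dots> \<le> (1 - x) * 1 + x * (1 / 2)" using assms by (intro powr_mult_le_convex) auto
  finally show ?thesis by simp
qed

text \<open>On the left, each of the M ladder steps contributes 2M; the last step contributes q from
  \<open>max 1 s\<close> and the 2 of its factor 2r'. The right side is shaped so that its q-th root
  is linear in q.\<close>

lemma iteration_constant_le:
  fixes q :: real and M :: nat
  assumes "1 < q" "real M \<le> q" "1 \<le> M"
  shows "2 * q * (2 * real M) ^ M \<le> (8 * q) powr q"
proof -
  have M: "(2 * real M) ^ M \<le> (2 * q) powr q"
  proof -
    have "(2 * real M) ^ M = (2 * real M) powr real M" using assms by (simp add: powr_realpow)
    also have "\<dots> \<le> (2 * q) powr real M" using assms by (intro powr_mono2) auto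
    also have "\<dots> \<le> (2 * q) powr q" using assms by (intro powr_mono) auto
    finally show ?thesis .
  qed
  have "2 powr q \<ge> 1 + q"
  proof -
    have "(2 powr q) powr (1 / q) * 1 powr (1 - 1 / q) \<le> (1 / q) * 2 powr q + (1 - 1 / q) * 1"
      using powr_mult_le_convex[of 1 "2 powr q" "1 / q"] assms by simp
    then have "2 \<le> (1 / q) * 2 powr q + (1 - 1 / q)" using assms by (simp add: powr_powr)
    then have "q * 2 \<le> q * ((1 / q) * 2 powr q + (1 - 1 / q))" using assms by (intro mult_left_mono) auto
    also have "\<dots> = 2 powr q + q - 1" using assms by (simp add: field_simps)
    finally show ?thesis by simp
  qed
  then have "(1 + q) * (1 + q) \<le> 2 powr q * 2 powr q" using assms by (intro mult_mono) auto
  also have "\<dots> = 4 powr q" by (simp flip: powr_mult)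
  finally have "2 * q \<le> 4 powr q"
    using zero_le_power2[of "q - 1"] assms by (simp add: power2_eq_square algebra_simps)
  then have "2 * q * (2 * real M) ^ M \<le> 4 powr q * (2 * q) powr q"
    using M assms by (intro mult_mono) auto
  also have "\<dots> = (8 * q) powr q" using assms by (simp flip: powr_mult)
  finally show ?thesis .
qed

section \<open>Iteration along half packings\<close>

text \<open>Countable additivity of the measure with density \<open>h\<close>. Subsets
  \<open>X D\<close> are allowed because the iteration integrates only over a part of each
  subcube.\<close>

lemma nn_integral_UN_countable:
  assumes "countable \<D>" "disjoint \<D>" "\<And>D. D \<in> \<D> \<Longrightarrow> D \<in> sets M" "h \<in> borel_measurable M"
    and "\<And>D. D \<in> \<D> \<Longrightarrow> X D \<in> sets M" "\<And>D. D \<in> \<D> \<Longrightarrow> X D \<subseteq> D"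
  shows "(\<integral>\<^sup>+x\<in>\<Union>(X ` \<D>). h x \<partial>M) = (\<integral>\<^sup>+D. (\<integral>\<^sup>+x\<in>X D. h x \<partial>M) \<partial>count_space \<D>)"
proof -
  have *: "emeasure (density M h) (\<Union>(X ` \<D>)) = (\<integral>\<^sup>+D. emeasure (density M h) (X D) \<partial>count_space \<D>)"
  proof (rule emeasure_UN_countable)
    show "disjoint_family_on X \<D>"
      unfolding disjoint_family_on_def using assms(6) disjointD[OF assms(2)] by blast
  qed (use assms in auto)
  have "\<Union>(X ` \<D>) \<in> sets M" using assms by (intro sets.countable_UN'') auto
  then have "emeasure (density M h) (\<Union>(X ` \<D>)) = (\<integral>\<^sup>+x\<in>\<Union>(X ` \<D>). h x \<partial>M)"
    using assms by (simp add: emeasure_density)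
  moreover have "(\<integral>\<^sup>+D. emeasure (density M h) (X D) \<partial>count_space \<D>)
      = (\<integral>\<^sup>+D. (\<integral>\<^sup>+x\<in>X D. h x \<partial>M) \<partial>count_space \<D>)"
    using assms by (intro nn_integral_cong) (auto simp: emeasure_density)
  ultimately show ?thesis using * by simp
qed

lemma emeasure_Union_disjoint:
  assumes "countable \<D>" "disjoint \<D>" "\<D> \<subseteq> sets M"
  shows "emeasure M (\<Union>\<D>) = (\<integral>\<^sup>+D. emeasure M D \<partial>count_space \<D>)"
  using emeasure_UN_countable[of \<D> "\<lambda>D. D" M] assms
  by (auto simp: disjoint_family_on_def disjoint_def subset_iff)

lemma nn_integral_Union_disjoint:
  assumes "countable \<D>" "disjoint \<D>" "\<D> \<subseteq> sets M" "h \<in> borel_measurable M"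
  shows "(\<integral>\<^sup>+x\<in>\<Union>\<D>. h x \<partial>M) = (\<integral>\<^sup>+D. (\<integral>\<^sup>+x\<in>D. h x \<partial>M) \<partial>count_space \<D>)"
proof -
  have "D \<in> sets M" if "D \<in> \<D>" for D using assms(3) that by blast
  from nn_integral_UN_countable[OF assms(1,2) this assms(4), of "\<lambda>D. D"] this show ?thesis by simp
qed

text \<open>Only measure-theoretic data are recorded, so the iteration runs in any measure space;
  cubes enter later through the family from which the packings are drawn.\<close>

definition half_packing :: "'a measure \<Rightarrow> 'a set \<Rightarrow> 'a set set \<Rightarrow> bool" where
  "half_packing M R \<D> \<longleftrightarrow> countable \<D> \<and> disjoint \<D> \<and> \<D> \<subseteq> sets M \<and> \<D> \<subseteq> Pow R \<and>
    measure M (\<Union>\<D>) \<le> measure M R / 2"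

text \<open>Hoelder's inequality for sums with exponents 1/(1 - \<theta>) and 1/\<theta>; the factor
  1/2 from the packing appears to the power 1 - \<theta>. It serves for h = \<sigma> on the ladder
  and for h = w^r in the last step.\<close>

lemma nn_integral_measure_powr_le:
  fixes \<theta> :: real
  assumes pack: "half_packing M R \<D>"
    and R: "R \<in> sets M" "emeasure M R < \<infinity>" "0 < measure M R"
    and h: "set_integrable M R h" "\<And>x. 0 \<le> h x" "0 < (LINT x:R|M. h x)"
    and \<theta>: "0 \<le> \<theta>" "\<theta> \<le> 1"
  shows "(\<integral>\<^sup>+D. ennreal (measure M D powr (1 - \<theta>) * (LINT x:D|M. h x) powr \<theta>) \<partial>count_space \<D>)
    \<le> ennreal (2 powr (- (1 - \<theta>)) * (measure M R powr (1 - \<theta>) * (LINT x:R|M. h x) powr \<theta>))"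
proof -
  have D: "countable \<D>" "disjoint \<D>" "\<And>D. D \<in> \<D> \<Longrightarrow> D \<in> sets M" "\<And>D. D \<in> \<D> \<Longrightarrow> D \<subseteq> R"
    and half: "measure M (\<Union>\<D>) \<le> measure M R / 2"
    using pack by (auto simp: half_packing_def)
  define m where "m = measure M R / 2"
  define I where "I = (LINT x:R|M. h x)"
  have mI: "m > 0" "I > 0" using R h by (auto simp: m_def I_def)
  \<comment> \<open>The value that Hoelder's inequality should give. With the measures scaled by
    \<open>m\<close> and the integrals by \<open>I\<close>, the weighted mean inequality is linear
    in each \<open>D\<close>, and the two resulting sums contribute (1 - \<theta>) c and \<theta>
    c.\<close>
  define c where "c = m powr (1 - \<theta>) * I powr \<theta>"
  have c: "c \<ge> 0" by (simp add: c_def)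
  have hD: "set_integrable M D h" if "D \<in> \<D>" for D
    using set_integrable_subset[OF h(1)] D that by auto
  have Dfin: "emeasure M D < \<infinity>" if "D \<in> \<D>" for D
    using emeasure_mono[OF D(4)[OF that] R(1)] R(2) by (rule order_le_less_trans)
  have 1: "measure M D powr (1 - \<theta>) * (LINT x:D|M. h x) powr \<theta>
      \<le> c * ((1 - \<theta>) / m) * measure M D + c * (\<theta> / I) * (LINT x:D|M. h x)" if "D \<in> \<D>" for D
  proof -
    have nn: "0 \<le> (LINT x:D|M. h x)"
      unfolding set_lebesgue_integral_def using h by (intro integral_nonneg_AE) auto
    have "measure M D powr (1 - \<theta>) * (LINT x:D|M. h x) powr \<theta>
      = c * ((measure M D / m) powr (1 - \<theta>) * ((LINT x:D|M. h x) / I) powr \<theta>)"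
      using mI nn by (simp add: c_def powr_divide)
    also have "\<dots> \<le> c * ((1 - \<theta>) * (measure M D / m) + \<theta> * ((LINT x:D|M. h x) / I))"
      using \<theta> mI nn c by (intro mult_left_mono powr_mult_le_convex) auto
    finally show ?thesis by (simp add: algebra_simps)
  qed
  have eq1: "(\<integral>\<^sup>+D. ennreal (measure M D) \<partial>count_space \<D>) \<le> ennreal m"
  proof -
    have "(\<integral>\<^sup>+D. ennreal (measure M D) \<partial>count_space \<D>) = (\<integral>\<^sup>+D. emeasure M D \<partial>count_space \<D>)"
      using Dfin by (intro nn_integral_cong) (simp add: emeasure_eq_ennreal_measure less_top)
    also have "\<dots> = emeasure M (\<Union>\<D>)"
      using D by (intro emeasure_Union_disjoint[symmetric]) auto
    also have "\<dots> = ennreal (measure M (\<Union>\<D>))"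
    proof -
      have "emeasure M (\<Union>\<D>) \<le> emeasure M R" using D R by (intro emeasure_mono) auto
      then show ?thesis using R by (intro emeasure_eq_ennreal_measure) (auto simp: top_unique)
    qed
    finally show ?thesis using half by (simp add: m_def ennreal_leI)
  qed
  have hmeas: "(\<lambda>x. ennreal (h x * indicator R x)) \<in> borel_measurable M"
    using borel_measurable_integrable[OF h(1)[unfolded set_integrable_def]] by (simp add: mult.commute)
  have conv: "ennreal (LINT x:D|M. h x) = (\<integral>\<^sup>+x\<in>D. ennreal (h x * indicator R x) \<partial>M)"
    if "set_integrable M D h" "D \<subseteq> R" for D
    using that h unfolding set_lebesgue_integral_def set_integrable_def
    by (subst nn_integral_eq_integral[symmetric])
       (auto intro!: nn_integral_cong simp: indicator_def split: if_splits)
  have eq2: "(\<integral>\<^sup>+D. ennreal (LINT x:D|M. h x) \<partial>count_space \<D>) \<le> ennreal I"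
  proof -
    have "(\<integral>\<^sup>+D. ennreal (LINT x:D|M. h x) \<partial>count_space \<D>)
       = (\<integral>\<^sup>+D. (\<integral>\<^sup>+x\<in>D. ennreal (h x * indicator R x) \<partial>M) \<partial>count_space \<D>)"
      using hD D conv by (intro nn_integral_cong) auto
    also have "\<dots> = (\<integral>\<^sup>+x\<in>\<Union>\<D>. ennreal (h x * indicator R x) \<partial>M)"
      using nn_integral_UN_countable[OF D(1-3) hmeas, of "\<lambda>D. D"] D by simp
    also have "\<dots> \<le> (\<integral>\<^sup>+x\<in>R. ennreal (h x * indicator R x) \<partial>M)"
      using D by (intro nn_integral_mono) (auto simp: indicator_def)
    also have "\<dots> = ennreal I" using conv[OF h(1)] by (simp add: I_def)
    finally show ?thesis .
  qed
  have nn: "0 \<le> (LINT x:D|M. h x)" for D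
    unfolding set_lebesgue_integral_def using h by (intro integral_nonneg_AE) auto
  have "(\<integral>\<^sup>+D. ennreal (measure M D powr (1 - \<theta>) * (LINT x:D|M. h x) powr \<theta>) \<partial>count_space \<D>)
     \<le> (\<integral>\<^sup>+D. ennreal (c * ((1 - \<theta>) / m)) * ennreal (measure M D)
          + ennreal (c * (\<theta> / I)) * ennreal (LINT x:D|M. h x) \<partial>count_space \<D>)"
    using 1 c mI \<theta> nn
    by (intro nn_integral_mono) (auto simp: ennreal_mult[symmetric] ennreal_plus[symmetric] intro!: ennreal_leI simp del: ennreal_plus)
  also have "\<dots> = ennreal (c * ((1 - \<theta>) / m)) * (\<integral>\<^sup>+D. ennreal (measure M D) \<partial>count_space \<D>)
     + ennreal (c * (\<theta> / I)) * (\<integral>\<^sup>+D. ennreal (LINT x:D|M. h x) \<partial>count_space \<D>)"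
    by (simp add: nn_integral_add nn_integral_cmult)
  also have "\<dots> \<le> ennreal (c * ((1 - \<theta>) / m)) * ennreal m + ennreal (c * (\<theta> / I)) * ennreal I"
    using eq1 eq2 by (intro add_mono mult_left_mono) auto
  also have "\<dots> = ennreal c"
  proof -
    have "ennreal (c * ((1 - \<theta>) / m)) * ennreal m + ennreal (c * (\<theta> / I)) * ennreal I
        = ennreal (c * ((1 - \<theta>) / m) * m + c * (\<theta> / I) * I)"
    proof -
      have "ennreal u * ennreal m + ennreal v * ennreal I = ennreal (u * m + v * I)"
        if "u \<ge> 0" "v \<ge> 0" for u v
        using that mI by (simp add: ennreal_mult)
      then show ?thesis using c mI \<theta> by simp
    qed
    also have "c * ((1 - \<theta>) / m) * m + c * (\<theta> / I) * I = c" using mI by (simp add: field_simps)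
    finally show ?thesis .
  qed
  also have "c = 2 powr (- (1 - \<theta>)) * (measure M R powr (1 - \<theta>) * (LINT x:R|M. h x) powr \<theta>)"
    unfolding c_def m_def I_def using R by (simp add: powr_divide powr_minus_divide[of 2 "1 - \<theta>"] del: minus_diff_eq)
  finally show ?thesis .
qed

text \<open>\<open>powr_le_step\<close> is applied pointwise, with T = 0 off the packing and T =
  \<open>G D x\<close> on each \<open>D\<close>. The error term lives on the same set
  \<open>H'\<close> as the left side and the children appear only through \<open>H D\<close>, so
  truncated integrals are estimated by truncated integrals alone.\<close>

lemma nn_integral_powr_one_step:
  fixes s t \<alpha> :: real
  assumes pack: "half_packing M R \<D>" and R: "R \<in> sets M"
    and F: "F \<in> borel_measurable M" "\<And>x. 0 \<le> F x"
    and G: "\<And>D. D \<in> \<D> \<Longrightarrow> G D \<in> borel_measurable M" "\<And>D x. D \<in> \<D> \<Longrightarrow> 0 \<le> G D x"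
    and \<sigma>: "\<sigma> \<in> borel_measurable M"
    and \<alpha>: "0 \<le> \<alpha>" and t: "0 < t" "t \<le> 1" "t \<le> s"
    and out: "AE x in M. x \<in> R - \<Union>\<D> \<longrightarrow> F x \<le> \<alpha>"
    and ins: "\<And>D. D \<in> \<D> \<Longrightarrow> AE x in M. x \<in> D \<longrightarrow> F x \<le> \<alpha> + G D x"
    and H: "\<And>D. D \<in> \<D> \<Longrightarrow> H D \<in> sets M" "\<And>D. D \<in> \<D> \<Longrightarrow> H D \<subseteq> D"
    and H': "H' = (R - \<Union>\<D>) \<union> \<Union>(H ` \<D>)"
  shows "(\<integral>\<^sup>+x\<in>H'. ennreal (F x powr s) * \<sigma> x \<partial>M)
    \<le> (\<integral>\<^sup>+D. (\<integral>\<^sup>+x\<in>H D. ennreal (G D x powr s) * \<sigma> x \<partial>M) \<partial>count_space \<D>)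
      + ennreal (max 1 s * \<alpha> powr t) * (\<integral>\<^sup>+x\<in>H'. ennreal (F x powr (s - t)) * \<sigma> x \<partial>M)"
proof -
  define c where "c = max 1 s * \<alpha> powr t"
  have c: "c \<ge> 0" by (simp add: c_def)
  have D: "countable \<D>" "disjoint \<D>" "\<And>D. D \<in> \<D> \<Longrightarrow> D \<in> sets M" "\<And>D. D \<in> \<D> \<Longrightarrow> D \<subseteq> R"
    using pack by (auto simp: half_packing_def)
  note [measurable] = F(1) G(1) \<sigma> R
  define U where "U = \<Union>(H ` \<D>)"
  define V where "V = R - \<Union>\<D>"
  have UV[measurable]: "U \<in> sets M" "V \<in> sets M"
    unfolding U_def V_def using D H R by (auto intro!: sets.countable_UN'' sets.countable_Union)
  have UV0: "U \<inter> V = {}" using H by (auto simp: U_def V_def)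
  have H'eq: "H' = U \<union> V" by (auto simp: H' U_def V_def)
  have split: "(\<integral>\<^sup>+x\<in>H'. f x \<partial>M) = (\<integral>\<^sup>+x\<in>U. f x \<partial>M) + (\<integral>\<^sup>+x\<in>V. f x \<partial>M)"
    if "f \<in> borel_measurable M" for f
    unfolding H'eq using that UV UV0 by (intro nn_integral_disjoint_pair) auto
  have UN: "(\<integral>\<^sup>+x\<in>U. f x \<partial>M) = (\<integral>\<^sup>+D. (\<integral>\<^sup>+x\<in>H D. f x \<partial>M) \<partial>count_space \<D>)"
    if "f \<in> borel_measurable M" for f
    unfolding U_def using D H that by (intro nn_integral_UN_countable) auto
  have V: "(\<integral>\<^sup>+x\<in>V. ennreal (F x powr s) * \<sigma> x \<partial>M)
      \<le> ennreal c * (\<integral>\<^sup>+x\<in>V. ennreal (F x powr (s - t)) * \<sigma> x \<partial>M)"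
  proof -
    have "(\<integral>\<^sup>+x\<in>V. ennreal (F x powr s) * \<sigma> x \<partial>M)
       \<le> (\<integral>\<^sup>+x. ennreal c * (ennreal (F x powr (s - t)) * \<sigma> x * indicator V x) \<partial>M)"
    proof (intro nn_integral_mono_AE, use out in eventually_elim)
      case (elim x)
      show ?case
      proof (cases "x \<in> V")
        case True
        then have "F x powr s \<le> 0 powr s + c * F x powr (s - t)"
          unfolding c_def using elim F \<alpha> t by (intro powr_le_step) (auto simp: V_def)
        then have "ennreal (F x powr s) \<le> ennreal c * ennreal (F x powr (s - t))"
          using c by (simp add: ennreal_mult'[symmetric] ennreal_leI)
        then show ?thesis using True by (simp add: mult.assoc[symmetric] mult_right_mono)
      qed auto
    qed
    also have "\<dots> = ennreal c * (\<integral>\<^sup>+x\<in>V. ennreal (F x powr (s - t)) * \<sigma> x \<partial>M)"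
      by (intro nn_integral_cmult) auto
    finally show ?thesis .
  qed
  have HD: "(\<integral>\<^sup>+x\<in>H D. ennreal (F x powr s) * \<sigma> x \<partial>M)
      \<le> (\<integral>\<^sup>+x\<in>H D. ennreal (G D x powr s) * \<sigma> x \<partial>M)
       + ennreal c * (\<integral>\<^sup>+x\<in>H D. ennreal (F x powr (s - t)) * \<sigma> x \<partial>M)" if D': "D \<in> \<D>" for D
  proof -
    note [measurable] = G(1)[OF D'] H(1)[OF D']
    have "(\<integral>\<^sup>+x\<in>H D. ennreal (F x powr s) * \<sigma> x \<partial>M)
       \<le> (\<integral>\<^sup>+x. ennreal (G D x powr s) * \<sigma> x * indicator (H D) x
            + ennreal c * (ennreal (F x powr (s - t)) * \<sigma> x * indicator (H D) x) \<partial>M)"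
    proof (intro nn_integral_mono_AE, use ins[OF D'] in eventually_elim)
      case (elim x)
      show ?case
      proof (cases "x \<in> H D")
        case True
        then have "x \<in> D" using H(2)[OF D'] by auto
        then have "F x powr s \<le> G D x powr s + c * F x powr (s - t)"
          unfolding c_def using elim F G(2)[OF D'] \<alpha> t by (intro powr_le_step) auto
        then have "ennreal (F x powr s) \<le> ennreal (G D x powr s) + ennreal c * ennreal (F x powr (s - t))"
          using c by (simp add: ennreal_mult'[symmetric] ennreal_plus[symmetric] ennreal_leI del: ennreal_plus)
        then have "ennreal (F x powr s) * \<sigma> x
            \<le> (ennreal (G D x powr s) + ennreal c * ennreal (F x powr (s - t))) * \<sigma> x"
          by (intro mult_right_mono) auto
        then show ?thesis using True by (simp add: mult.assoc distrib_right)
      qed auto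
    qed
    also have "\<dots> = (\<integral>\<^sup>+x\<in>H D. ennreal (G D x powr s) * \<sigma> x \<partial>M)
       + ennreal c * (\<integral>\<^sup>+x\<in>H D. ennreal (F x powr (s - t)) * \<sigma> x \<partial>M)"
      by (subst nn_integral_add) (auto simp: nn_integral_cmult)
    finally show ?thesis .
  qed
  have "(\<integral>\<^sup>+x\<in>U. ennreal (F x powr s) * \<sigma> x \<partial>M)
     = (\<integral>\<^sup>+D. (\<integral>\<^sup>+x\<in>H D. ennreal (F x powr s) * \<sigma> x \<partial>M) \<partial>count_space \<D>)"
    by (intro UN) auto
  also have "\<dots> \<le> (\<integral>\<^sup>+D. (\<integral>\<^sup>+x\<in>H D. ennreal (G D x powr s) * \<sigma> x \<partial>M)
       + ennreal c * (\<integral>\<^sup>+x\<in>H D. ennreal (F x powr (s - t)) * \<sigma> x \<partial>M) \<partial>count_space \<D>)"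
    using HD by (intro nn_integral_mono) auto
  also have "\<dots> = (\<integral>\<^sup>+D. (\<integral>\<^sup>+x\<in>H D. ennreal (G D x powr s) * \<sigma> x \<partial>M) \<partial>count_space \<D>)
       + ennreal c * (\<integral>\<^sup>+D. (\<integral>\<^sup>+x\<in>H D. ennreal (F x powr (s - t)) * \<sigma> x \<partial>M) \<partial>count_space \<D>)"
    by (simp add: nn_integral_add nn_integral_cmult)
  also have "(\<integral>\<^sup>+D. (\<integral>\<^sup>+x\<in>H D. ennreal (F x powr (s - t)) * \<sigma> x \<partial>M) \<partial>count_space \<D>)
      = (\<integral>\<^sup>+x\<in>U. ennreal (F x powr (s - t)) * \<sigma> x \<partial>M)"
    by (intro UN[symmetric]) auto
  finally have U: "(\<integral>\<^sup>+x\<in>U. ennreal (F x powr s) * \<sigma> x \<partial>M)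
    \<le> (\<integral>\<^sup>+D. (\<integral>\<^sup>+x\<in>H D. ennreal (G D x powr s) * \<sigma> x \<partial>M) \<partial>count_space \<D>)
      + ennreal c * (\<integral>\<^sup>+x\<in>U. ennreal (F x powr (s - t)) * \<sigma> x \<partial>M)" .
  have e1: "(\<integral>\<^sup>+x\<in>H'. ennreal (F x powr s) * \<sigma> x \<partial>M)
     = (\<integral>\<^sup>+x\<in>U. ennreal (F x powr s) * \<sigma> x \<partial>M) + (\<integral>\<^sup>+x\<in>V. ennreal (F x powr s) * \<sigma> x \<partial>M)"
    by (intro split) auto
  have e2: "(\<integral>\<^sup>+x\<in>H'. ennreal (F x powr (s - t)) * \<sigma> x \<partial>M)
     = (\<integral>\<^sup>+x\<in>U. ennreal (F x powr (s - t)) * \<sigma> x \<partial>M)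
       + (\<integral>\<^sup>+x\<in>V. ennreal (F x powr (s - t)) * \<sigma> x \<partial>M)"
    by (intro split) auto
  show ?thesis
    unfolding e1 e2 c_def[symmetric] using add_mono[OF U V] by (simp add: distrib_left add.assoc)
qed

text \<open>The set \<open>H\<close> of the proof consists of the points of \<open>R\<close> lying in fewer than \<open>n\<close> generations
  of packing cubes; the integrals over \<open>R\<close> itself could a priori be infinite.\<close>

lemma nn_integral_powr_iterate:
  fixes F :: "'a set \<Rightarrow> 'a \<Rightarrow> real" and \<alpha> :: "'a set \<Rightarrow> real" and \<sigma> :: "'a \<Rightarrow> ennreal"
    and s \<rho> :: "nat \<Rightarrow> real" and B :: "nat \<Rightarrow> 'a set \<Rightarrow> real"
  assumes \<Q>: "\<And>R. R \<in> \<Q> \<Longrightarrow> R \<in> sets M" "\<And>R. R \<in> \<Q> \<Longrightarrow> emeasure M R < \<infinity>"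
    and F: "\<And>R. R \<in> \<Q> \<Longrightarrow> F R \<in> borel_measurable M" "\<And>R x. R \<in> \<Q> \<Longrightarrow> 0 \<le> F R x"
    and \<sigma>: "\<sigma> \<in> borel_measurable M"
    and \<alpha>: "\<And>R. R \<in> \<Q> \<Longrightarrow> 0 \<le> \<alpha> R"
    and packing: "\<And>R. R \<in> \<Q> \<Longrightarrow> \<exists>\<D>\<subseteq>\<Q>. half_packing M R \<D>
      \<and> (AE x in M. x \<in> R - \<Union>\<D> \<longrightarrow> F R x \<le> \<alpha> R)
      \<and> (\<forall>D\<in>\<D>. AE x in M. x \<in> D \<longrightarrow> F R x \<le> \<alpha> R + F D x)"
    and s: "s 0 = 0" "\<And>i. i < L \<Longrightarrow> s i < s (Suc i)" "\<And>i. i < L \<Longrightarrow> s (Suc i) \<le> s i + 1"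
    and B: "\<And>i R. R \<in> \<Q> \<Longrightarrow> i \<le> L \<Longrightarrow> 0 \<le> B i R"
    and \<rho>: "\<And>i. 0 \<le> \<rho> i"
    and B0: "\<And>R. R \<in> \<Q> \<Longrightarrow> (\<integral>\<^sup>+x\<in>R. \<sigma> x \<partial>M) \<le> ennreal (B 0 R)"
    and B_step: "\<And>i R. i < L \<Longrightarrow> R \<in> \<Q> \<Longrightarrow>
      max 1 (s (Suc i)) * \<alpha> R powr (s (Suc i) - s i) * B i R \<le> (1 - \<rho> (Suc i)) * B (Suc i) R"
    and B_sum: "\<And>i R \<D>. i < L \<Longrightarrow> R \<in> \<Q> \<Longrightarrow> \<D> \<subseteq> \<Q> \<Longrightarrow> half_packing M R \<D> \<Longrightarrow>
      (\<integral>\<^sup>+D. ennreal (B (Suc i) D) \<partial>count_space \<D>) \<le> ennreal (\<rho> (Suc i) * B (Suc i) R)"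
    and R: "R \<in> \<Q>" and i: "i \<le> L"
  shows "(\<integral>\<^sup>+x\<in>R. ennreal (F R x powr s i) * \<sigma> x \<partial>M) \<le> ennreal (B i R)"
proof -
  have s_nonneg: "0 \<le> s i" if "i \<le> L" for i
    using that by (induction i) (auto simp: s(1) Suc_le_eq intro: order_trans[OF _ less_imp_le[OF s(2)]])
  \<comment> \<open>One set \<open>H\<close> must serve all exponents at once, since raising the
    exponent from \<open>s i\<close> to \<open>s (Suc i)\<close> uses the bound for
    \<open>s i\<close> on that same set. With no generation allowed, \<open>H\<close> is
    empty.\<close>
  have step: "\<exists>H\<in>sets M. H \<subseteq> R \<and> emeasure M (R - H) \<le> ennreal (measure M R / 2 ^ n) \<and>
      (\<forall>i\<le>L. (\<integral>\<^sup>+x\<in>H. ennreal (F R x powr s i) * \<sigma> x \<partial>M) \<le> ennreal (B i R))" if "R \<in> \<Q>" for n R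
    using that
  proof (induction n arbitrary: R)
    case 0
    show ?case using \<Q>[OF 0]
      by (intro bexI[of _ "{}"]) (auto simp: emeasure_eq_ennreal_measure less_top)
  next
    case (Suc n)
    note R = \<open>R \<in> \<Q>\<close>
    obtain \<D> where \<D>: "\<D> \<subseteq> \<Q>" and pack: "half_packing M R \<D>"
      and out: "AE x in M. x \<in> R - \<Union>\<D> \<longrightarrow> F R x \<le> \<alpha> R"
      and ins: "\<And>D. D \<in> \<D> \<Longrightarrow> AE x in M. x \<in> D \<longrightarrow> F R x \<le> \<alpha> R + F D x"
      using packing[OF R] by auto
    have D: "countable \<D>" "disjoint \<D>" "\<And>D. D \<in> \<D> \<Longrightarrow> D \<in> sets M" "\<And>D. D \<in> \<D> \<Longrightarrow> D \<subseteq> R"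
      and half: "measure M (\<Union>\<D>) \<le> measure M R / 2"
      using pack by (auto simp: half_packing_def)
    have "\<forall>D\<in>\<D>. \<exists>H. H \<in> sets M \<and> H \<subseteq> D \<and> emeasure M (D - H) \<le> ennreal (measure M D / 2 ^ n) \<and>
      (\<forall>i\<le>L. (\<integral>\<^sup>+x\<in>H. ennreal (F D x powr s i) * \<sigma> x \<partial>M) \<le> ennreal (B i D))"
      using Suc.IH \<D> by blast
    from bchoice[OF this] obtain H where H: "\<And>D. D \<in> \<D> \<Longrightarrow> H D \<in> sets M" "\<And>D. D \<in> \<D> \<Longrightarrow> H D \<subseteq> D"
      and Hm: "\<And>D. D \<in> \<D> \<Longrightarrow> emeasure M (D - H D) \<le> ennreal (measure M D / 2 ^ n)"
      and HI: "\<And>D i. D \<in> \<D> \<Longrightarrow> i \<le> L \<Longrightarrow>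
         (\<integral>\<^sup>+x\<in>H D. ennreal (F D x powr s i) * \<sigma> x \<partial>M) \<le> ennreal (B i D)"
      by auto
    define H' where "H' = (R - \<Union>\<D>) \<union> \<Union>(H ` \<D>)"
    have Union: "\<Union>\<D> \<in> sets M" using D by (intro sets.countable_Union) auto
    have H'm: "H' \<in> sets M"
      unfolding H'_def using D H \<Q>[OF R] Union by (auto intro!: sets.countable_UN'')
    have H'R: "H' \<subseteq> R" unfolding H'_def using H D by blast
    have small: "emeasure M (R - H') \<le> ennreal (measure M R / 2 ^ Suc n)"
    proof -
      have "emeasure M (R - H') \<le> emeasure M (\<Union>D\<in>\<D>. D - H D)"
        using D H by (intro emeasure_mono sets.countable_UN'') (auto simp: H'_def)
      also have "\<dots> = (\<integral>\<^sup>+D. emeasure M (D - H D) \<partial>count_space \<D>)"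
      proof (intro emeasure_UN_countable)
        show "disjoint_family_on (\<lambda>D. D - H D) \<D>"
          unfolding disjoint_family_on_def using disjointD[OF D(2)] by blast
      qed (use D H in auto)
      also have "\<dots> \<le> (\<integral>\<^sup>+D. ennreal (1 / 2 ^ n) * emeasure M D \<partial>count_space \<D>)"
      proof (intro nn_integral_mono)
        fix D assume "D \<in> space (count_space \<D>)"
        then have D': "D \<in> \<D>" by simp
        then have "emeasure M D = ennreal (measure M D)"
          using \<Q>(2) \<D> by (intro emeasure_eq_ennreal_measure) (auto simp: less_top)
        with Hm[OF D'] show "emeasure M (D - H D) \<le> ennreal (1 / 2 ^ n) * emeasure M D"
          by (simp add: ennreal_mult'[symmetric])
      qed
      also have "\<dots> = ennreal (1 / 2 ^ n) * (\<integral>\<^sup>+D. emeasure M D \<partial>count_space \<D>)"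
        by (intro nn_integral_cmult) auto
      also have "(\<integral>\<^sup>+D. emeasure M D \<partial>count_space \<D>) = emeasure M (\<Union>\<D>)"
        using D by (intro emeasure_Union_disjoint[symmetric]) auto
      also have "emeasure M (\<Union>\<D>) = ennreal (measure M (\<Union>\<D>))"
      proof -
        have "emeasure M (\<Union>\<D>) \<le> emeasure M R" using D \<Q>[OF R] by (intro emeasure_mono) auto
        then show ?thesis using \<Q>(2)[OF R] by (intro emeasure_eq_ennreal_measure) (auto simp: top_unique)
      qed
      also have "ennreal (1 / 2 ^ n) * ennreal (measure M (\<Union>\<D>)) \<le> ennreal (1 / 2 ^ n) * ennreal (measure M R / 2)"
        using half by (intro mult_left_mono ennreal_leI) auto
      also have "\<dots> = ennreal (measure M R / 2 ^ Suc n)"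
        by (simp add: ennreal_mult'[symmetric] mult.commute)
      finally show ?thesis .
    qed
    \<comment> \<open>A second induction, now on the exponent with \<open>H'\<close> fixed: the
      children's terms come from the outer hypothesis for fewer generations, the error term from the
      inner one.\<close>
    have "(\<integral>\<^sup>+x\<in>H'. ennreal (F R x powr s i) * \<sigma> x \<partial>M) \<le> ennreal (B i R)" if "i \<le> L" for i
      using that
    proof (induction i)
      case 0
      have "(\<integral>\<^sup>+x\<in>H'. ennreal (F R x powr s 0) * \<sigma> x \<partial>M) \<le> (\<integral>\<^sup>+x\<in>R. \<sigma> x \<partial>M)"
        using H'R by (intro nn_integral_mono) (auto simp: s(1) indicator_def split: if_splits)
      also note B0[OF R]
      finally show ?case .
    next
      case (Suc i)
      then have i: "i < L" by simp
      let ?t = "s (Suc i) - s i" and ?c = "max 1 (s (Suc i)) * \<alpha> R powr (s (Suc i) - s i)"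
      have "(\<integral>\<^sup>+x\<in>H'. ennreal (F R x powr s (Suc i)) * \<sigma> x \<partial>M)
        \<le> (\<integral>\<^sup>+D. (\<integral>\<^sup>+x\<in>H D. ennreal (F D x powr s (Suc i)) * \<sigma> x \<partial>M) \<partial>count_space \<D>)
         + ennreal ?c * (\<integral>\<^sup>+x\<in>H'. ennreal (F R x powr (s (Suc i) - ?t)) * \<sigma> x \<partial>M)"
        by (rule nn_integral_powr_one_step[OF pack _ _ _ _ _ _ _ _ _ _ out ins H H'_def])
           (use F \<D> R \<Q> \<sigma> \<alpha>[OF R] s(2,3)[OF i] s_nonneg[of i] i in auto)
      also have "\<dots> \<le> (\<integral>\<^sup>+D. ennreal (B (Suc i) D) \<partial>count_space \<D>) + ennreal ?c * ennreal (B i R)"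
        using Suc HI by (intro add_mono nn_integral_mono mult_left_mono) auto
      \<comment> \<open>The budget \<open>B (Suc i) R\<close> is divided into a share
        \<open>\<rho>\<close> for the children and a share \<open>1 - \<rho>\<close> for the error
        term.\<close>
      also have "\<dots> \<le> ennreal (\<rho> (Suc i) * B (Suc i) R) + ennreal ((1 - \<rho> (Suc i)) * B (Suc i) R)"
      proof (intro add_mono B_sum[OF i R \<D> pack])
        show "ennreal ?c * ennreal (B i R) \<le> ennreal ((1 - \<rho> (Suc i)) * B (Suc i) R)"
          using B_step[OF i R] by (subst ennreal_mult'[symmetric]) (auto intro!: ennreal_leI)
      qed
      also have "\<dots> = ennreal (\<rho> (Suc i) * B (Suc i) R + (1 - \<rho> (Suc i)) * B (Suc i) R)"
      proof (rule ennreal_plus[symmetric])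
        show "0 \<le> \<rho> (Suc i) * B (Suc i) R" using \<rho> B[OF R, of "Suc i"] i by simp
        have "0 \<le> ?c * B i R" using B[OF R, of i] i by simp
        with B_step[OF i R] show "0 \<le> (1 - \<rho> (Suc i)) * B (Suc i) R" by linarith
      qed
      also have "\<dots> = ennreal (B (Suc i) R)" by (simp add: algebra_simps)
      finally show ?case .
    qed
    with H'm H'R small show ?case by blast
  qed
  define u where "u x = ennreal (F R x powr s i) * \<sigma> x" for x
  have u[measurable]: "u \<in> borel_measurable M" unfolding u_def using F(1)[OF R] \<sigma> by measurable
  have "\<forall>n. \<exists>H. H \<in> sets M \<and> H \<subseteq> R \<and> emeasure M (R - H) \<le> ennreal (measure M R / 2 ^ n) \<and>
      (\<forall>i\<le>L. (\<integral>\<^sup>+x\<in>H. ennreal (F R x powr s i) * \<sigma> x \<partial>M) \<le> ennreal (B i R))"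
    using step[OF R] by blast
  from choice[OF this] obtain H where H: "\<And>n. H n \<in> sets M" "\<And>n. H n \<subseteq> R"
    and Hm: "\<And>n. emeasure M (R - H n) \<le> ennreal (measure M R / 2 ^ n)"
    and HI: "\<And>n. (\<integral>\<^sup>+x\<in>H n. u x \<partial>M) \<le> ennreal (B i R)"
    unfolding u_def using i by blast
  \<comment> \<open>The sets \<open>H n\<close> are chosen separately for each \<open>n\<close> and
    are not known to increase, so Borel-Cantelli and Fatou's lemma replace monotone convergence:
    almost every point of \<open>R\<close> lies in all but finitely many of them.\<close>
  have ev: "AE x in M. eventually (\<lambda>n. x \<in> space M - (R - H n)) sequentially"
  proof (rule borel_cantelli_AE1)
    show "R - H n \<in> sets M" for n using H \<Q>[OF R] by auto
    show "emeasure M (R - H n) < \<infinity>" for n using Hm[of n] by (simp add: order_le_less_trans)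
    show "summable (\<lambda>n. measure M (R - H n))"
    proof (rule summable_comparison_test')
      show "summable (\<lambda>n. measure M R * (1 / 2) ^ n)" by (intro summable_mult summable_geometric) auto
      show "norm (measure M (R - H n)) \<le> measure M R * (1 / 2) ^ n" for n
        using Hm[of n] unfolding measure_def[of M "R - H n"]
        by (simp add: enn2real_leI power_divide)
    qed
  qed
  have "(\<integral>\<^sup>+x\<in>R. u x \<partial>M) \<le> (\<integral>\<^sup>+x. liminf (\<lambda>n. u x * indicator (H n) x) \<partial>M)"
  proof (intro nn_integral_mono_AE, rule AE_mp[OF ev], intro AE_I2 impI)
    fix x assume x: "eventually (\<lambda>n. x \<in> space M - (R - H n)) sequentially"
    show "u x * indicator R x \<le> liminf (\<lambda>n. u x * indicator (H n) x)"
    proof (cases "x \<in> R")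
      case True
      have "eventually (\<lambda>n. u x \<le> u x * indicator (H n) x) sequentially"
        using x by (rule eventually_mono) (use True in auto)
      then have "u x \<le> liminf (\<lambda>n. u x * indicator (H n) x)" by (intro Liminf_bounded)
      then show ?thesis using True by simp
    qed auto
  qed
  also have "\<dots> \<le> liminf (\<lambda>n. \<integral>\<^sup>+x\<in>H n. u x \<partial>M)" using H by (intro nn_integral_liminf) auto
  also have "\<dots> \<le> ennreal (B i R)"
  proof -
    have "liminf (\<lambda>n. \<integral>\<^sup>+x\<in>H n. u x \<partial>M) \<le> liminf (\<lambda>n. ennreal (B i R))"
      by (intro Liminf_mono always_eventually allI HI)
    then show ?thesis by (simp add: Liminf_const)
  qed
  finally show ?thesis by (simp add: u_def)
qed

text \<open>Here the budgets are chosen. The weights \<sigma> and \<open>v\<close> (later w^(1-q)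
  and w^r) are linked only through the bound \<open>K\<close>; nothing else of their relation to a
  common weight enters.\<close>

lemma nn_integral_powr_le_of_packing:
  fixes F :: "'a set \<Rightarrow> 'a \<Rightarrow> real" and \<sigma> v :: "'a \<Rightarrow> real" and p r A K :: real
  defines "q \<equiv> p / (p - 1)"
  assumes \<Q>: "\<And>R. R \<in> \<Q> \<Longrightarrow> R \<in> sets M" "\<And>R. R \<in> \<Q> \<Longrightarrow> emeasure M R < \<infinity>"
      "\<And>R. R \<in> \<Q> \<Longrightarrow> 0 < measure M R"
    and F: "\<And>R. R \<in> \<Q> \<Longrightarrow> F R \<in> borel_measurable M" "\<And>R x. R \<in> \<Q> \<Longrightarrow> 0 \<le> F R x"
    and \<sigma>: "\<sigma> \<in> borel_measurable M" "\<And>x. 0 \<le> \<sigma> x" "\<And>R. R \<in> \<Q> \<Longrightarrow> set_integrable M R \<sigma>"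
      "\<And>R. R \<in> \<Q> \<Longrightarrow> 0 < (LINT x:R|M. \<sigma> x)"
    and v: "\<And>x. 0 \<le> v x" "\<And>R. R \<in> \<Q> \<Longrightarrow> set_integrable M R v"
      "\<And>R. R \<in> \<Q> \<Longrightarrow> 0 < (LINT x:R|M. v x)"
    and p: "1 < p" and r: "1 < r" and A: "0 < A"
    and K: "\<And>R. R \<in> \<Q> \<Longrightarrow>
      ((LINT x:R|M. v x) / measure M R) powr (1 / r) * ((LINT x:R|M. \<sigma> x) / measure M R) powr (p - 1) \<le> K"
    and packing: "\<And>R. R \<in> \<Q> \<Longrightarrow> \<exists>\<D>\<subseteq>\<Q>. half_packing M R \<D>
      \<and> (AE x in M. x \<in> R - \<Union>\<D> \<longrightarrow> F R x \<le> A * ((LINT x:R|M. v x) / measure M R) powr (1 / r))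
      \<and> (\<forall>D\<in>\<D>. AE x in M. x \<in> D \<longrightarrow>
           F R x \<le> A * ((LINT x:R|M. v x) / measure M R) powr (1 / r) + F D x)"
    and Q: "Q \<in> \<Q>"
  shows "(\<integral>\<^sup>+x\<in>Q. ennreal (F Q x powr q) * ennreal (\<sigma> x) \<partial>M)
    \<le> ennreal ((8 * q * A) powr q * K powr (q - 1) * (r / (r - 1))
        * (measure M Q * ((LINT x:Q|M. v x) / measure M Q) powr (1 / r)))"
proof -
  define m where "m R = measure M R" for R
  define S where "S R = (LINT x:R|M. \<sigma> x)" for R
  define V where "V R = (LINT x:R|M. v x)" for R
  define a where "a R = (V R / m R) powr (1 / r)" for R
  have pos: "0 < m R" "0 < S R" "0 < V R" "0 < a R" if "R \<in> \<Q>" for R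
    using \<Q>(3)[OF that] \<sigma>(4)[OF that] v(3)[OF that] by (auto simp: m_def S_def V_def a_def)
  have K': "a R * (S R / m R) powr (p - 1) \<le> K" if "R \<in> \<Q>" for R
    using K[OF that] by (simp add: a_def V_def S_def m_def)
  have q: "1 < q" "(p - 1) * (q - 1) = 1" using p by (auto simp: q_def field_simps)
  have "0 < a Q * (S Q / m Q) powr (p - 1)" using pos[OF Q] by simp
  also have "\<dots> \<le> K" by (rule K'[OF Q])
  finally have Kpos: "K > 0" .
  \<comment> \<open>The least number of equal steps covering q - 1 with length at most 1, as
    \<open>powr_le_step\<close> requires; being below q, it keeps the final constant under
    control.\<close>
  define L where "L = nat \<lceil>q - 1\<rceil>"
  have "real L = of_int \<lceil>q - 1\<rceil>" using q by (simp add: L_def)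
  then have L: "q - 1 \<le> real L" "real L < q" using q by linarith+
  then have L1: "1 \<le> L" using q by (cases L) auto
  define t where "t = (q - 1) / real L"
  have t: "0 < t" "t \<le> 1" using q L L1 by (auto simp: t_def field_simps)
  have Lt: "real L * t = q - 1" using L1 by (simp add: t_def)
  \<comment> \<open>The value beyond \<open>L\<close> is needed only at \<open>Suc L\<close>; since
    \<open>s L\<close> = q - 1, that last step has length exactly 1.\<close>
  define s where "s i = (if i \<le> L then real i * t else q)" for i
  \<comment> \<open>The contraction factors of \<open>nn_integral_measure_powr_le\<close>: the
    exponent of \<open>m R\<close> in \<open>B i R\<close> is i/L on the ladder and 1 - 1/r at the
    end.\<close>
  define \<rho> where "\<rho> i = (if i \<le> L then 2 powr (- (real i / real L)) else 2 powr (- (1 - 1 / r)))" for i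
  \<comment> \<open>The first budgets interpolate between \<sigma>(R) and |R|, gaining 2L and one
    factor (AK)^t per step. The last one is a multiple of |R| a_R, written as a product of powers so
    that the same Hoelder estimate sums it over a packing.\<close>
  define B where "B i R = (if i \<le> L
      then (2 * real L) ^ i * (A * K) powr (real i * t) * (m R powr (real i / real L) * S R powr (1 - real i / real L))
      else q * (2 * (r / (r - 1))) * (2 * real L) ^ L * (A powr q * K powr (q - 1))
        * (m R powr (1 - 1 / r) * V R powr (1 / r)))" for i R
  have *: "(\<integral>\<^sup>+x\<in>Q. ennreal (F Q x powr s (Suc L)) * ennreal (\<sigma> x) \<partial>M) \<le> ennreal (B (Suc L) Q)"
  proof (rule nn_integral_powr_iterate[where \<Q> = \<Q> and \<alpha> = "\<lambda>R. A * a R" and L = "Suc L" and \<rho> = \<rho>])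
    show "\<exists>\<D>\<subseteq>\<Q>. half_packing M R \<D> \<and> (AE x in M. x \<in> R - \<Union>\<D> \<longrightarrow> F R x \<le> A * a R)
      \<and> (\<forall>D\<in>\<D>. AE x in M. x \<in> D \<longrightarrow> F R x \<le> A * a R + F D x)" if "R \<in> \<Q>" for R
      using packing[OF that] by (simp add: a_def V_def m_def)
    show "s i < s (Suc i)" if "i < Suc L" for i
      using that t Lt q by (auto simp: s_def algebra_simps less_Suc_eq)
    show "s (Suc i) \<le> s i + 1" if "i < Suc L" for i
      using that t Lt q by (auto simp: s_def algebra_simps less_Suc_eq)
    show "0 \<le> B i R" if "R \<in> \<Q>" "i \<le> Suc L" for i R
      unfolding B_def using q r by (auto intro!: mult_nonneg_nonneg)
    show "0 \<le> \<rho> i" for i by (simp add: \<rho>_def)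
    show "(\<integral>\<^sup>+x\<in>R. ennreal (\<sigma> x) \<partial>M) \<le> ennreal (B 0 R)" if R: "R \<in> \<Q>" for R
    proof -
      have "(\<integral>\<^sup>+x\<in>R. ennreal (\<sigma> x) \<partial>M) = ennreal (S R)"
        using \<sigma>(2) \<sigma>(3)[OF R] unfolding S_def set_lebesgue_integral_def set_integrable_def
        by (subst nn_integral_eq_integral[symmetric])
           (auto intro!: nn_integral_cong simp: indicator_def split: if_splits)
      then show ?thesis using pos[OF R] A Kpos by (simp add: B_def)
    qed
    show "max 1 (s (Suc i)) * (A * a R) powr (s (Suc i) - s i) * B i R \<le> (1 - \<rho> (Suc i)) * B (Suc i) R"
      if i: "i < Suc L" and R: "R \<in> \<Q>" for i R
    proof (cases "i < L")
      case True
      define \<theta> where "\<theta> = 1 - real (Suc i) / real L"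
      have ds: "s (Suc i) - s i = t" using True by (simp add: s_def algebra_simps)
      have mx: "max 1 (s (Suc i)) \<le> real (Suc i)"
        using True t mult_left_mono[of t 1 "real (Suc i)"] by (simp add: s_def)
      \<comment> \<open>Raising the bound by \<open>K\<close> to the power \<open>t\<close> leaves
        \<sigma>(R)/|R| with exponent (p - 1)t = 1/L, exactly one rung of the ladder.\<close>
      have aK: "a R powr t * S R powr (1 / real L) \<le> K powr t * m R powr (1 / real L)"
      proof -
        have "(a R * (S R / m R) powr (p - 1)) powr t \<le> K powr t"
          using K'[OF R] pos[OF R] t by (intro powr_mono2) auto
        also have "(a R * (S R / m R) powr (p - 1)) powr t = a R powr t * (S R / m R) powr ((p - 1) * t)"
          using pos[OF R] by (simp add: powr_mult powr_powr)
        also have "(p - 1) * t = 1 / real L" using q by (simp add: t_def)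
        finally show ?thesis using pos[OF R] by (simp add: powr_divide field_simps)
      qed
      have eS: "S R powr (1 - real i / real L) = S R powr (1 / real L) * S R powr \<theta>"
        by (simp add: \<theta>_def powr_add[symmetric] add_divide_distrib)
      have em: "m R powr (real (Suc i) / real L) = m R powr (1 / real L) * m R powr (real i / real L)"
        by (simp add: powr_add[symmetric] add_divide_distrib)
      have eK: "(A * K) powr (real (Suc i) * t) = A powr t * K powr t * (A * K) powr (real i * t)"
        using A Kpos by (simp add: powr_mult powr_add[symmetric] algebra_simps)
      \<comment> \<open>The cost from \<open>mx\<close> and the gain \<open>1 - \<rho>\<close> are
        both proportional to \<open>Suc i\<close>, so their quotient is at most 2L independently of
        the step.\<close>
      have r2: "real (Suc i) \<le> (1 - \<rho> (Suc i)) * (2 * real L)"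
      proof -
        have "real (Suc i) / real L / 2 \<le> 1 - 2 powr (- (real (Suc i) / real L))"
          using True by (intro two_powr_minus_le) auto
        then have "real (Suc i) / real L / 2 * (2 * real L) \<le> (1 - \<rho> (Suc i)) * (2 * real L)"
          using True by (intro mult_right_mono) (auto simp: \<rho>_def)
        then show ?thesis using L1 by simp
      qed
      define X where "X = (2 * real L) ^ i * (A * K) powr (real i * t) * m R powr (real i / real L) * S R powr \<theta> * A powr t"
      have X: "X \<ge> 0" by (auto simp: X_def intro!: mult_nonneg_nonneg)
      have "max 1 (s (Suc i)) * (A * a R) powr (s (Suc i) - s i) * B i R
         = max 1 (s (Suc i)) * (X * (a R powr t * S R powr (1 / real L)))"
        using True A pos[OF R] by (simp add: ds B_def eS X_def powr_mult mult_ac)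
      also have "\<dots> \<le> real (Suc i) * (X * (K powr t * m R powr (1 / real L)))"
        by (rule mult_mono[OF mx mult_left_mono[OF aK X]]) (use X in \<open>auto intro!: mult_nonneg_nonneg\<close>)
      also have "\<dots> \<le> (1 - \<rho> (Suc i)) * (2 * real L) * (X * (K powr t * m R powr (1 / real L)))"
        using r2 X by (intro mult_right_mono mult_nonneg_nonneg) auto
      also have "\<dots> = (1 - \<rho> (Suc i)) * ((2 * real L) * (X * (K powr t * m R powr (1 / real L))))"
        by (simp only: mult.assoc)
      also have "(2 * real L) * (X * (K powr t * m R powr (1 / real L))) = B (Suc i) R"
      proof -
        have "B (Suc i) R = (2 * real L) ^ Suc i * (A * K) powr (real (Suc i) * t)
          * (m R powr (real (Suc i) / real L) * S R powr \<theta>)"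
          using True by (simp add: B_def \<theta>_def)
        then show ?thesis unfolding em eK X_def by (simp only: power_Suc mult_ac)
      qed
      finally show ?thesis .
    next
      case False
      then have iL: "i = L" using i by simp
      have ds: "s (Suc i) - s i = 1" "max 1 (s (Suc i)) = q" using Lt q by (auto simp: s_def iL)
      \<comment> \<open>The gain of the last step is at least 1/(2r'); this is the only source of
        the factor r'.\<close>
      have r2: "1 \<le> (1 - \<rho> (Suc i)) * (2 * (r / (r - 1)))"
      proof -
        have "(1 - 1 / r) / 2 \<le> 1 - 2 powr (- (1 - 1 / r))"
          using r by (intro two_powr_minus_le) auto
        then have "(1 - 1 / r) / 2 * (2 * (r / (r - 1))) \<le> (1 - \<rho> (Suc i)) * (2 * (r / (r - 1)))"
          using r by (intro mult_right_mono) (auto simp: \<rho>_def iL)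
        moreover have "(1 - 1 / r) / 2 * (2 * (r / (r - 1))) = 1" using r by (simp add: field_simps)
        ultimately show ?thesis by (simp only:)
      qed
      have ma: "m R * a R = m R powr (1 - 1 / r) * V R powr (1 / r)"
        using pos[OF R] by (simp add: a_def powr_divide powr_diff)
      \<comment> \<open>At \<open>i = L\<close> the exponent of \<open>S R\<close> is zero and only
        |R| remains. The unit step multiplies it by A a_R, turning |R| into |R| a_R and A^(q-1) into
        A^q.\<close>
      have B: "B i R = (2 * real L) ^ L * (A powr (q - 1) * K powr (q - 1)) * m R"
        using L1 pos[OF R] A Kpos by (simp add: B_def iL Lt powr_mult)
      have Aq: "A powr q = A * A powr (q - 1)" using A by (simp add: powr_diff)
      define X where "X = q * (2 * real L) ^ L * (A powr q * K powr (q - 1)) * (m R * a R)"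
      have X: "X \<ge> 0" using q pos[OF R] by (auto simp: X_def intro!: mult_nonneg_nonneg)
      have "max 1 (s (Suc i)) * (A * a R) powr (s (Suc i) - s i) * B i R = 1 * X"
        unfolding ds B X_def Aq using A pos[OF R] by (simp add: mult_ac)
      also have "\<dots> \<le> (1 - \<rho> (Suc i)) * (2 * (r / (r - 1))) * X"
        using r2 X by (intro mult_right_mono)
      also have "\<dots> = (1 - \<rho> (Suc i)) * (q * (2 * (r / (r - 1))) * (2 * real L) ^ L * (A powr q * K powr (q - 1))
          * (m R powr (1 - 1 / r) * V R powr (1 / r)))"
        unfolding ma[symmetric] X_def by (simp only: mult_ac)
      also have "\<dots> = (1 - \<rho> (Suc i)) * B (Suc i) R" by (simp add: B_def iL)
      finally show ?thesis .
    qed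
    show "(\<integral>\<^sup>+D. ennreal (B (Suc i) D) \<partial>count_space \<D>) \<le> ennreal (\<rho> (Suc i) * B (Suc i) R)"
      if i: "i < Suc L" and R: "R \<in> \<Q>" and "\<D> \<subseteq> \<Q>" and pack: "half_packing M R \<D>" for i R \<D>
    proof -
      have mult: "(\<integral>\<^sup>+D. ennreal (c * g D) \<partial>count_space \<D>) \<le> ennreal (\<rho>' * (c * g'))"
        if "(\<integral>\<^sup>+D. ennreal (g D) \<partial>count_space \<D>) \<le> ennreal (\<rho>' * g')" "0 \<le> c" for c \<rho>' g' g
      proof -
        have "(\<integral>\<^sup>+D. ennreal (c * g D) \<partial>count_space \<D>) = ennreal c * (\<integral>\<^sup>+D. ennreal (g D) \<partial>count_space \<D>)"
          using that(2) by (simp add: ennreal_mult' nn_integral_cmult)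
        also have "\<dots> \<le> ennreal c * ennreal (\<rho>' * g')" using that(1) by (intro mult_left_mono) auto
        also have "\<dots> = ennreal (\<rho>' * (c * g'))"
          using that(2) by (simp add: ennreal_mult'[symmetric] mult_ac)
        finally show ?thesis .
      qed
      note powr_le = nn_integral_measure_powr_le[OF pack \<Q>[OF R]]
      show ?thesis
      proof (cases "i < L")
        case True
        show ?thesis
          using mult[OF powr_le[OF \<sigma>(3)[OF R] \<sigma>(2) \<sigma>(4)[OF R], of "1 - real (Suc i) / real L"],
            of "(2 * real L) ^ Suc i * (A * K) powr (real (Suc i) * t)"] True
          by (simp add: B_def \<rho>_def m_def S_def)
      next
        case False
        then have iL: "i = L" using i by simp
        show ?thesis
          using mult[OF powr_le[OF v(2)[OF R] v(1) v(3)[OF R], of "1 / r"],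
            of "q * (2 * (r / (r - 1))) * (2 * real L) ^ L * (A powr q * K powr (q - 1))"] q r
          by (simp add: B_def \<rho>_def m_def V_def iL)
      qed
    qed
  qed (use \<Q> F \<sigma> Q pos A in \<open>auto simp: s_def less_imp_le\<close>)
  have ma: "m Q * a Q = m Q powr (1 - 1 / r) * V Q powr (1 / r)"
    using pos[OF Q] by (simp add: a_def powr_divide powr_diff)
  have "B (Suc L) Q = 2 * q * (2 * real L) ^ L * (A powr q * K powr (q - 1) * (r / (r - 1)) * (m Q * a Q))"
    by (simp add: B_def ma)
  also have "\<dots> \<le> (8 * q) powr q * (A powr q * K powr (q - 1) * (r / (r - 1)) * (m Q * a Q))"
    using iteration_constant_le[of q L] q L L1 r pos[OF Q]
    by (intro mult_right_mono) (auto intro!: mult_nonneg_nonneg)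
  also have "\<dots> = (8 * q * A) powr q * K powr (q - 1) * (r / (r - 1)) * (m Q * a Q)"
    using q A by (simp add: powr_mult)
  finally have "ennreal (B (Suc L) Q) \<le> ennreal ((8 * q * A) powr q * K powr (q - 1) * (r / (r - 1)) * (m Q * a Q))"
    by (rule ennreal_leI)
  with * have "(\<integral>\<^sup>+x\<in>Q. ennreal (F Q x powr s (Suc L)) * ennreal (\<sigma> x) \<partial>M)
    \<le> ennreal ((8 * q * A) powr q * K powr (q - 1) * (r / (r - 1)) * (m Q * a Q))" by (rule order_trans)
  then show ?thesis by (simp add: s_def m_def a_def V_def)
qed

section \<open>Dyadic cubes and the Calderon--Zygmund decomposition\<close>

text \<open>Half-open cubes, so that the dyadic cubes of each generation form a genuine partition.\<close>

definition hcube :: "real^'n::finite \<Rightarrow> real \<Rightarrow> (real^'n) set" where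
  "hcube a l = {x. \<forall>i. a $ i \<le> x $ i \<and> x $ i < a $ i + l}"

definition hcubes :: "(real^'n::finite) set set" where
  "hcubes = {hcube a l | a l. l > 0}"

lemma One_nth: "(One :: real^'n::finite) $ i = 1"
proof -
  have "(One :: real^'n) $ i = (One :: real^'n) \<bullet> axis i 1" by (rule cart_eq_inner_axis)
  also have "\<dots> = 1" using inner_sum_left_Basis[of "axis i 1 :: real^'n" "\<lambda>_. 1"] by (simp add: axis_in_Basis_iff)
  finally show ?thesis .
qed

lemma hcube_subset_cbox: "hcube a l \<subseteq> cbox a (a + l *\<^sub>R One)"
proof
  fix x assume "x \<in> hcube a l"
  then have "a $ i \<le> x $ i \<and> x $ i \<le> (a + l *\<^sub>R One) $ i" for i
    using One_nth[of i] unfolding hcube_def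
    by (auto simp del: sum_component dest: spec[of _ i])
  then show "x \<in> cbox a (a + l *\<^sub>R One)" unfolding mem_box_cart by blast
qed

lemma box_subset_hcube: "box a (a + l *\<^sub>R One) \<subseteq> hcube a l"
  by (auto simp: hcube_def mem_box_cart One_nth simp del: sum_component intro: less_imp_le)

lemma sets_hcube [measurable, simp]: "hcube a l \<in> sets lebesgue"
proof -
  have "hcube a l = (\<Inter>i\<in>UNIV. {x. a $ i \<le> x $ i \<and> x $ i < a $ i + l})"
    by (auto simp: hcube_def)
  also have "\<dots> \<in> sets borel" by measurable
  finally show ?thesis by (simp add: sets_completionI_sets)
qed

lemma AE_hcube_iff_cbox: "AE x in lebesgue. x \<in> hcube a l \<longleftrightarrow> x \<in> cbox a (a + l *\<^sub>R One)"
proof -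
  have "cbox a (a + l *\<^sub>R One) - box a (a + l *\<^sub>R One) \<in> null_sets lebesgue"
    using negligible_frontier_interval negligible_iff_null_sets by blast
  from AE_not_in[OF this] show ?thesis
    by eventually_elim (use hcube_subset_cbox box_subset_hcube in blast)
qed

lemma emeasure_hcube:
  fixes a :: "real^'n::finite"
  assumes "l \<ge> 0"
  shows "emeasure lebesgue (hcube a l) = ennreal (l ^ CARD('n))"
proof -
  have "emeasure lebesgue (hcube a l) = emeasure lebesgue (cbox a (a + l *\<^sub>R One))"
    using AE_hcube_iff_cbox by (intro emeasure_eq_AE) auto
  also have "\<dots> = ennreal (l ^ CARD('n))"
    using assms by (simp add: emeasure_lborel_cbox_eq inner_sum_left_Basis inner_add_left)
  finally show ?thesis .
qed

lemma measure_hcube: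
  fixes a :: "real^'n::finite"
  assumes "l \<ge> 0"
  shows "measure lebesgue (hcube a l) = l ^ CARD('n)"
  using emeasure_hcube[OF assms, of a] assms by (simp add: measure_def)

section \<open>The dyadic grid and its stopping cubes\<close>

definition dyadic_index :: "real^'n::finite \<Rightarrow> real \<Rightarrow> nat \<Rightarrow> real^'n \<Rightarrow> 'n \<Rightarrow> int" where
  "dyadic_index a l m x i = \<lfloor>2 ^ m * ((x $ i - a $ i) / l)\<rfloor>"

text \<open>As fibres of the index map, cubes of one generation coincide as soon as they meet, with
  no geometry involved. A cube is named by any of its points; that it is a half-open cube is
  \<open>dyadic_eq_hcube\<close>.\<close>

definition dyadic :: "real^'n::finite \<Rightarrow> real \<Rightarrow> nat \<Rightarrow> real^'n \<Rightarrow> (real^'n) set" where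
  "dyadic a l m x = {y. dyadic_index a l m y = dyadic_index a l m x}"

lemma mem_dyadic_self [simp]: "x \<in> dyadic a l m x"
  by (simp add: dyadic_def)

lemma dyadic_eq: "y \<in> dyadic a l m x \<Longrightarrow> dyadic a l m y = dyadic a l m x"
  by (simp add: dyadic_def)

lemma dyadic_eq_hcube:
  assumes "l > 0"
  shows "dyadic a l m x = hcube (\<chi> i. a $ i + l / 2 ^ m * of_int (dyadic_index a l m x i)) (l / 2 ^ m)"
proof -
  have "dyadic_index a l m y i = k \<longleftrightarrow>
      a $ i + l / 2 ^ m * of_int k \<le> y $ i \<and> y $ i < a $ i + l / 2 ^ m * of_int k + l / 2 ^ m" for y i k
  proof -
    have "dyadic_index a l m y i = k \<longleftrightarrow>
        of_int k \<le> 2 ^ m * ((y $ i - a $ i) / l) \<and> 2 ^ m * ((y $ i - a $ i) / l) < of_int k + 1"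
      unfolding dyadic_index_def by (simp add: floor_eq_iff)
    also have "of_int k \<le> 2 ^ m * ((y $ i - a $ i) / l) \<longleftrightarrow> a $ i + l / 2 ^ m * of_int k \<le> y $ i"
      using assms by (simp add: field_simps)
    also have "2 ^ m * ((y $ i - a $ i) / l) < of_int k + 1
        \<longleftrightarrow> y $ i < a $ i + l / 2 ^ m * of_int k + l / 2 ^ m"
      using assms by (simp add: field_simps)
    finally show ?thesis .
  qed
  then show ?thesis by (auto simp: dyadic_def hcube_def fun_eq_iff)
qed

lemma dyadic_in_hcubes: "l > 0 \<Longrightarrow> dyadic a l m x \<in> hcubes"
  unfolding hcubes_def mem_Collect_eq using dyadic_eq_hcube[of l a m x]
  by (intro exI[of _ "\<chi> i. a $ i + l / 2 ^ m * of_int (dyadic_index a l m x i)"] exI[of _ "l / 2 ^ m"]) simp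

lemma sets_dyadic [simp]: "l > 0 \<Longrightarrow> dyadic a l m x \<in> sets lebesgue"
  by (simp add: dyadic_eq_hcube)

lemma emeasure_dyadic:
  fixes a :: "real^'n::finite"
  shows "l > 0 \<Longrightarrow> emeasure lebesgue (dyadic a l m x) = ennreal ((l / 2 ^ m) ^ CARD('n))"
  by (subst dyadic_eq_hcube, assumption, rule emeasure_hcube) simp

lemma dyadic_0:
  assumes "l > 0" "x \<in> hcube a l"
  shows "dyadic a l 0 x = hcube a l"
proof -
  have "dyadic_index a l 0 x i = 0" for i
    using assms by (auto simp: dyadic_index_def hcube_def floor_eq_iff field_simps)
  then show ?thesis using assms(1) by (simp add: dyadic_eq_hcube)
qed

text \<open>The coarser index is the finer one divided by a power of 2 and rounded down, so the
  finer index determines the coarser.\<close>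

lemma dyadic_antimono:
  assumes "m \<le> n"
  shows "dyadic a l n x \<subseteq> dyadic a l m x"
proof -
  have "dyadic_index a l m y i = dyadic_index a l n y i div 2 ^ (n - m)" for y i
  proof -
    have "2 ^ m * ((y $ i - a $ i) / l) = 2 ^ n * ((y $ i - a $ i) / l) / of_int (2 ^ (n - m))"
    proof -
      have "(2 :: real) ^ n = 2 ^ m * 2 ^ (n - m)" using assms by (simp flip: power_add)
      then show ?thesis by simp
    qed
    then show ?thesis unfolding dyadic_index_def by (simp only: floor_divide_real_eq_div zero_le_power zero_le_numeral)
  qed
  then have "dyadic_index a l m y = (\<lambda>i. dyadic_index a l n y i div 2 ^ (n - m))" for y
    by (simp add: fun_eq_iff)
  then show ?thesis by (auto simp: dyadic_def)
qed

lemma dyadic_subset_hcube: "l > 0 \<Longrightarrow> x \<in> hcube a l \<Longrightarrow> dyadic a l m x \<subseteq> hcube a l"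
  using dyadic_antimono[of 0 m a l x] dyadic_0[of l x a] by simp

lemma dyadic_subset_open:
  fixes a :: "real^'n::finite"
  assumes "l > 0" "open T" "x \<in> T"
  shows "\<exists>m. dyadic a l m x \<subseteq> T"
proof -
  obtain e where e: "e > 0" "ball x e \<subseteq> T" using assms by (auto simp: open_contains_ball)
  have "(\<lambda>m. real CARD('n) * l * (1 / 2) ^ m) \<longlonglongrightarrow> real CARD('n) * l * 0"
    by (intro tendsto_mult_left LIMSEQ_power_zero) auto
  then have "eventually (\<lambda>m. real CARD('n) * l * (1 / 2) ^ m < e) sequentially"
    using e by (simp add: order_tendstoD)
  then obtain m where m: "real CARD('n) * l * (1 / 2) ^ m < e" by (auto simp: eventually_sequentially)
  have "dist x y < e" if y: "y \<in> dyadic a l m x" for y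
  proof -
    have "\<bar>(x - y) $ i\<bar> \<le> l / 2 ^ m" for i
    proof -
      have "x \<in> dyadic a l m x" by simp
      with y show ?thesis unfolding dyadic_eq_hcube[OF assms(1)] hcube_def mem_Collect_eq
        by (elim allE[of _ i]) (auto simp: abs_le_iff)
    qed
    then have "norm (x - y) \<le> (\<Sum>i::'n\<in>UNIV. l / 2 ^ m)"
      by (intro order_trans[OF norm_le_l1_cart] sum_mono)
    then show ?thesis using m by (simp add: dist_norm power_divide)
  qed
  then show ?thesis using e by (intro exI[of _ m]) auto
qed

text \<open>The maximal dyadic subcubes with property \<open>P\<close>. Leaving \<open>P\<close>
  arbitrary lets one selection serve both the cover inside an open set and the decomposition by
  large averages.\<close>

definition stopping_cubes :: "real^'n::finite \<Rightarrow> real \<Rightarrow> ((real^'n) set \<Rightarrow> bool) \<Rightarrow> (real^'n) set set" where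
  "stopping_cubes a l P = {dyadic a l m x | m x.
     x \<in> hcube a l \<and> P (dyadic a l m x) \<and> (\<forall>j<m. \<not> P (dyadic a l j x))}"

lemma countable_stopping_cubes: "countable (stopping_cubes a l P)"
proof -
  have "stopping_cubes a l P \<subseteq> range (\<lambda>(m, k). {y. dyadic_index a l m y = k})"
    by (auto simp: stopping_cubes_def dyadic_def)
  then show ?thesis by (rule countable_subset) simp
qed

text \<open>Two cubes with a common point have the same ancestors up to the generation of the larger
  one, so the larger would be an ancestor of the smaller that already satisfies
  \<open>P\<close>.\<close>

lemma disjoint_stopping_cubes: "disjoint (stopping_cubes a l P)"
proof (rule disjointI)
  fix C D assume "C \<in> stopping_cubes a l P" "D \<in> stopping_cubes a l P" "C \<noteq> D"
  then obtain m x n y where C: "C = dyadic a l m x" "P C" "\<And>j. j < m \<Longrightarrow> \<not> P (dyadic a l j x)"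
    and D: "D = dyadic a l n y" "P D" "\<And>j. j < n \<Longrightarrow> \<not> P (dyadic a l j y)"
    by (auto simp: stopping_cubes_def)
  show "C \<inter> D = {}"
  proof (rule ccontr)
    assume "C \<inter> D \<noteq> {}"
    then obtain z where z: "z \<in> dyadic a l m x" "z \<in> dyadic a l n y" using C D by auto
    have x: "dyadic a l j z = dyadic a l j x" if "j \<le> m" for j
      using z dyadic_antimono[OF that] by (intro dyadic_eq) auto
    have y: "dyadic a l j z = dyadic a l j y" if "j \<le> n" for j
      using z dyadic_antimono[OF that] by (intro dyadic_eq) auto
    consider "m < n" | "n < m" | "m = n" by linarith
    then show False
    proof cases
      case 1
      then show False using D(3)[OF 1] x[of m] y[of m] C by simp
    next
      case 2
      then show False using C(3)[OF 2] x[of n] y[of n] D by simp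
    next
      case 3
      then show False using x[of m] y[of m] C D \<open>C \<noteq> D\<close> by simp
    qed
  qed
qed

lemma stopping_cubesE:
  assumes "D \<in> stopping_cubes a l P"
  obtains m x where "x \<in> hcube a l" "D = dyadic a l m x" "P D" "\<And>j. j < m \<Longrightarrow> \<not> P (dyadic a l j x)"
  using assms by (auto simp: stopping_cubes_def)

lemma Union_stopping_cubes:
  assumes "x \<in> hcube a l" "P (dyadic a l m x)"
  shows "x \<in> \<Union>(stopping_cubes a l P)"
proof -
  define k where "k = (LEAST k. P (dyadic a l k x))"
  have "P (dyadic a l k x)" unfolding k_def using assms(2) by (rule LeastI[of "\<lambda>k. P (dyadic a l k x)" m])
  moreover have "\<not> P (dyadic a l j x)" if "j < k" for j
    using not_less_Least[of j "\<lambda>k. P (dyadic a l k x)"] that by (simp add: k_def)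
  ultimately have "dyadic a l k x \<in> stopping_cubes a l P"
    using assms(1) by (auto simp: stopping_cubes_def)
  then show ?thesis by (rule UnionI) simp
qed

lemma stopping_cubes_subset: "l > 0 \<Longrightarrow> stopping_cubes a l P \<subseteq> Pow (hcube a l)"
  by (auto elim!: stopping_cubesE dest: dyadic_subset_hcube)

lemma stopping_cubes_hcubes: "l > 0 \<Longrightarrow> stopping_cubes a l P \<subseteq> hcubes"
  by (auto elim!: stopping_cubesE simp: dyadic_in_hcubes)

lemma stopping_cubes_sets: "l > 0 \<Longrightarrow> stopping_cubes a l P \<subseteq> sets lebesgue"
  by (rule subsetI, elim stopping_cubesE) (simp only: sets_dyadic)

declare emeasure_completion [simp del]

text \<open>Replaces Lebesgue differentiation: if \<open>F > \<mu> + \<delta>\<close> on a set \<open>E'\<close> of positive measure, cover \<open>E'\<close>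
  by disjoint dyadic cubes that meet \<open>E\<close> inside an open set barely larger than \<open>E'\<close>.\<close>

lemma AE_le_of_dyadic_averages:
  fixes a :: "real^'n::finite"
  assumes l: "l > 0" and F[measurable]: "F \<in> borel_measurable lebesgue" and E[measurable]: "E \<in> sets lebesgue"
    and EQ: "E \<subseteq> hcube a l" and lam: "0 \<le> \<mu>"
    and avg: "\<And>x m. x \<in> E \<Longrightarrow>
      (\<integral>\<^sup>+y\<in>dyadic a l m x. ennreal (F y) \<partial>lebesgue) \<le> ennreal \<mu> * emeasure lebesgue (dyadic a l m x)"
  shows "AE x in lebesgue. x \<in> E \<longrightarrow> F x \<le> \<mu>"
proof -
  have main: "AE x in lebesgue. \<not> (x \<in> E \<and> F x > \<mu> + \<delta>)" if \<delta>: "\<delta> > 0" for \<delta>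
  proof -
    define E' where "E' = E \<inter> {x. F x > \<mu> + \<delta>}"
    have "{x \<in> space lebesgue. F x > \<mu> + \<delta>} \<in> sets lebesgue" by measurable
    then have E'[measurable]: "E' \<in> sets lebesgue" unfolding E'_def using E by (simp add: sets.Int)
    have "emeasure lebesgue E' \<le> emeasure lebesgue (hcube a l)"
      using EQ by (intro emeasure_mono) (auto simp: E'_def)
    also have "\<dots> < \<infinity>" using l by (simp add: emeasure_hcube)
    finally have fin: "emeasure lebesgue E' = ennreal (measure lebesgue E')"
      by (intro emeasure_eq_ennreal_measure) simp
    \<comment> \<open>Comparing integrals over the cover gives (\<mu> + \<delta>)|E'| \<le>
      \<mu>(|E'| + \<epsilon>); as |E'| is finite, \<mu>|E'| cancels.\<close>
    have "\<delta> * measure lebesgue E' \<le> \<mu> * \<epsilon>" if \<epsilon>: "\<epsilon> > 0" for \<epsilon>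
    proof -
      obtain T where T: "open T" "E' \<subseteq> T" "T - E' \<in> lmeasurable" "emeasure lebesgue (T - E') < ennreal \<epsilon>"
        using sets_lebesgue_outer_open[OF E' \<epsilon>] by metis
      have Tm[measurable]: "T \<in> sets lebesgue" using T(1) by simp
      define \<D> where "\<D> = stopping_cubes a l (\<lambda>D. D \<subseteq> T \<and> D \<inter> E \<noteq> {})"
      have D: "countable \<D>" "disjoint \<D>" "\<D> \<subseteq> sets lebesgue"
        unfolding \<D>_def
        by (rule countable_stopping_cubes disjoint_stopping_cubes stopping_cubes_sets[OF l])+
      have DT: "\<Union>\<D> \<subseteq> T" unfolding \<D>_def by (auto elim!: stopping_cubesE)
      have E'D: "E' \<subseteq> \<Union>\<D>"
      proof
        fix x assume x: "x \<in> E'"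
        then obtain m where "dyadic a l m x \<subseteq> T" using dyadic_subset_open[OF l T(1), of x a] T(2) by blast
        moreover have "x \<in> E" "x \<in> hcube a l" using x EQ by (auto simp: E'_def)
        ultimately show "x \<in> \<Union>\<D>"
          unfolding \<D>_def using mem_dyadic_self[of x a l m] by (intro Union_stopping_cubes[of _ _ _ _ m]) blast+
      qed
      \<comment> \<open>The cube may be named by a point outside \<open>E\<close>, but it meets
        \<open>E\<close> and can be renamed by a point there, where the hypothesis on averages
        applies.\<close>
      have avgD: "(\<integral>\<^sup>+y\<in>D. ennreal (F y) \<partial>lebesgue) \<le> ennreal \<mu> * emeasure lebesgue D" if D\<D>: "D \<in> \<D>" for D
      proof -
        obtain m x where D: "D = dyadic a l m x" and DE: "D \<subseteq> T \<and> D \<inter> E \<noteq> {}"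
          using D\<D> unfolding \<D>_def by (rule stopping_cubesE)
        then obtain y where y: "y \<in> D" "y \<in> E" by auto
        then have "D = dyadic a l m y" using D dyadic_eq by blast
        then show ?thesis using avg y(2) by simp
      qed
      have UN: "(\<integral>\<^sup>+y\<in>\<Union>\<D>. f y \<partial>lebesgue) = (\<integral>\<^sup>+D. (\<integral>\<^sup>+y\<in>D. f y \<partial>lebesgue) \<partial>count_space \<D>)"
        if "f \<in> borel_measurable lebesgue" for f
        using D that by (rule nn_integral_Union_disjoint)
      have "ennreal (\<mu> + \<delta>) * emeasure lebesgue E' = (\<integral>\<^sup>+y\<in>E'. ennreal (\<mu> + \<delta>) \<partial>lebesgue)"
        by (simp add: nn_integral_cmult_indicator)
      also have "\<dots> \<le> (\<integral>\<^sup>+y\<in>\<Union>\<D>. ennreal (F y) \<partial>lebesgue)"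
        using E'D by (intro nn_integral_mono) (auto simp: indicator_def E'_def intro!: ennreal_leI)
      also have "\<dots> = (\<integral>\<^sup>+D. (\<integral>\<^sup>+y\<in>D. ennreal (F y) \<partial>lebesgue) \<partial>count_space \<D>)"
        by (intro UN) auto
      also have "\<dots> \<le> (\<integral>\<^sup>+D. ennreal \<mu> * emeasure lebesgue D \<partial>count_space \<D>)"
        using avgD by (intro nn_integral_mono) auto
      also have "\<dots> = ennreal \<mu> * emeasure lebesgue (\<Union>\<D>)"
        using D by (simp add: emeasure_Union_disjoint nn_integral_cmult)
      also have "\<dots> \<le> ennreal \<mu> * emeasure lebesgue (E' \<union> (T - E'))"
        using DT by (intro mult_left_mono emeasure_mono) auto
      also have "\<dots> \<le> ennreal \<mu> * (ennreal (measure lebesgue E') + ennreal \<epsilon>)"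
      proof (intro mult_left_mono)
        have "emeasure lebesgue (E' \<union> (T - E')) \<le> emeasure lebesgue E' + emeasure lebesgue (T - E')"
          by (intro emeasure_subadditive) auto
        also have "\<dots> \<le> ennreal (measure lebesgue E') + ennreal \<epsilon>"
          using T(4) by (intro add_mono) (auto simp: fin)
        finally show "emeasure lebesgue (E' \<union> (T - E')) \<le> ennreal (measure lebesgue E') + ennreal \<epsilon>" .
      qed auto
      also have "\<dots> = ennreal (\<mu> * (measure lebesgue E' + \<epsilon>))"
        using \<epsilon> lam by (simp add: ennreal_mult)
      finally have "ennreal ((\<mu> + \<delta>) * measure lebesgue E') \<le> ennreal (\<mu> * (measure lebesgue E' + \<epsilon>))"
        using lam \<delta> by (simp add: fin ennreal_mult)
      then have "(\<mu> + \<delta>) * measure lebesgue E' \<le> \<mu> * (measure lebesgue E' + \<epsilon>)"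
        using lam \<epsilon> by (simp add: ennreal_le_iff)
      then show ?thesis by (simp add: algebra_simps)
    qed
    note small = this
    have "\<delta> * measure lebesgue E' \<le> 0 + e" if e: "e > 0" for e
    proof (cases "\<mu> = 0")
      case True
      then show ?thesis using small[of 1] e by simp
    next
      case False
      then show ?thesis using small[of "e / \<mu>"] e lam by simp
    qed
    then have "\<delta> * measure lebesgue E' \<le> 0" by (rule field_le_epsilon)
    then have "measure lebesgue E' = 0" using \<delta> by (simp add: mult_le_0_iff measure_le_0_iff)
    then have "E' \<in> null_sets lebesgue" using fin by (intro null_setsI) auto
    from AE_not_in[OF this] show ?thesis by (auto simp: E'_def)
  qed
  have "AE x in lebesgue. \<forall>n::nat. \<not> (x \<in> E \<and> F x > \<mu> + 1 / real (Suc n))"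
    unfolding AE_all_countable by (intro allI main) simp
  then show ?thesis
  proof eventually_elim
    case (elim x)
    show ?case
    proof
      assume "x \<in> E"
      show "F x \<le> \<mu>"
      proof (rule ccontr)
        assume "\<not> F x \<le> \<mu>"
        then obtain n where "1 / real (Suc n) < F x - \<mu>"
          using nat_approx_posE[of "F x - \<mu>"] by auto
        with elim \<open>x \<in> E\<close> show False by (metis less_diff_eq add.commute)
      qed
    qed
  qed
qed

section \<open>The Calderon--Zygmund decomposition\<close>

lemma nn_integral_eq_set_integral:
  assumes "set_integrable lebesgue Q F" "\<And>x. 0 \<le> F x" "D \<in> sets lebesgue" "D \<subseteq> Q"
  shows "(\<integral>\<^sup>+x\<in>D. ennreal (F x) \<partial>lebesgue) = ennreal (LINT x:D|lebesgue. F x)"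
proof -
  have "set_integrable lebesgue D F" using assms(1,3,4) by (rule set_integrable_subset)
  then show ?thesis
    using assms(2) unfolding set_lebesgue_integral_def set_integrable_def
    by (subst nn_integral_eq_integral[symmetric])
       (auto intro!: nn_integral_cong simp: indicator_def split: if_splits)
qed

text \<open>Chebyshev's inequality at twice the mean selects at most half of the cube. The factor
  2^n is the ratio of the measure of a selected cube's parent, which was not selected, to its own.
  Off the selected cubes every dyadic average is at most \<mu>, which
  \<open>AE_le_of_dyadic_averages\<close> turns into a pointwise bound.\<close>

lemma calderon_zygmund:
  fixes a :: "real^'n::finite"
  assumes l: "l > 0" and Fm[measurable]: "F \<in> borel_measurable lebesgue" and F0: "\<And>x. 0 \<le> F x"
    and Fi: "set_integrable lebesgue (hcube a l) F"
  defines "\<mu> \<equiv> 2 * ((LINT x:hcube a l|lebesgue. F x) / measure lebesgue (hcube a l))"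
  obtains \<D> where "\<D> \<subseteq> hcubes" "half_packing lebesgue (hcube a l) \<D>"
    "AE x in lebesgue. x \<in> hcube a l - \<Union>\<D> \<longrightarrow> F x \<le> \<mu>"
    "\<And>D. D \<in> \<D> \<Longrightarrow> (LINT x:D|lebesgue. F x) \<le> 2 ^ CARD('n) * \<mu> * measure lebesgue D"
proof
  let ?Q = "hcube a l"
  have Qpos: "measure lebesgue ?Q > 0" using l by (simp add: measure_hcube)
  have INT0: "(LINT x:D|lebesgue. F x) \<ge> 0" for D
    unfolding set_lebesgue_integral_def using F0 by (intro integral_nonneg_AE) auto
  have lam0: "\<mu> \<ge> 0" unfolding \<mu>_def using INT0 Qpos by simp
  have lamQ: "(LINT x:?Q|lebesgue. F x) = \<mu> / 2 * measure lebesgue ?Q" using Qpos by (simp add: \<mu>_def)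
  define P where "P D \<longleftrightarrow> (LINT x:D|lebesgue. F x) > \<mu> * measure lebesgue D" for D
  define \<D> where "\<D> = stopping_cubes a l P"
  have D: "countable \<D>" "disjoint \<D>" "\<D> \<subseteq> sets lebesgue" "\<D> \<subseteq> Pow ?Q"
    unfolding \<D>_def
    by (rule countable_stopping_cubes disjoint_stopping_cubes stopping_cubes_sets[OF l]
      stopping_cubes_subset[OF l])+
  show "\<D> \<subseteq> hcubes" unfolding \<D>_def using stopping_cubes_hcubes[OF l] .
  have U[measurable]: "\<Union>\<D> \<in> sets lebesgue" using D by (intro sets.countable_Union) auto
  have UQ: "\<Union>\<D> \<subseteq> ?Q" using D by auto
  have fin: "emeasure lebesgue X = ennreal (measure lebesgue X)" if "X \<subseteq> ?Q" "X \<in> sets lebesgue" for X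
  proof -
    have "emeasure lebesgue X \<le> emeasure lebesgue ?Q" using that by (intro emeasure_mono) auto
    also have "\<dots> < \<infinity>" using l by (simp add: emeasure_hcube)
    finally show ?thesis by (intro emeasure_eq_ennreal_measure) simp
  qed
  have half: "measure lebesgue (\<Union>\<D>) \<le> measure lebesgue ?Q / 2"
  proof (cases "\<mu> = 0")
    case True
    \<comment> \<open>Chebyshev's inequality divides by \<mu>, so \<mu> = 0 is separate: the
      integral of \<open>F\<close> over the whole cube is then 0, and no subcube can exceed
      it.\<close>
    have "\<D> = {}"
    proof (rule ccontr)
      assume "\<D> \<noteq> {}"
      then obtain C where C: "C \<in> \<D>" by auto
      then have "P C" by (auto simp: \<D>_def elim: stopping_cubesE)
      then have "(LINT x:C|lebesgue. F x) > 0" using True by (simp add: P_def)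
      moreover have "ennreal (LINT x:C|lebesgue. F x) \<le> ennreal (LINT x:?Q|lebesgue. F x)"
      proof -
        have "C \<in> sets lebesgue" "C \<subseteq> ?Q" using C D by auto
        then show ?thesis
          using nn_integral_eq_set_integral[OF Fi F0, of C] nn_integral_eq_set_integral[OF Fi F0, of ?Q]
          by (auto intro!: nn_integral_mono simp flip: nn_integral_eq_set_integral[OF Fi F0] simp: indicator_def)
      qed
      moreover have "(LINT x:?Q|lebesgue. F x) = 0" using lamQ True by simp
      ultimately show False by (simp add: ennreal_le_iff2)
    qed
    then show ?thesis using Qpos by simp
  next
    case False
    then have lam: "\<mu> > 0" using lam0 by simp
    have "ennreal \<mu> * emeasure lebesgue (\<Union>\<D>) = (\<integral>\<^sup>+D. ennreal \<mu> * emeasure lebesgue D \<partial>count_space \<D>)"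
      using D by (simp add: emeasure_Union_disjoint nn_integral_cmult)
    also have "\<dots> \<le> (\<integral>\<^sup>+D. (\<integral>\<^sup>+x\<in>D. ennreal (F x) \<partial>lebesgue) \<partial>count_space \<D>)"
    proof (intro nn_integral_mono)
      fix C assume "C \<in> space (count_space \<D>)"
      then have C: "C \<in> \<D>" by simp
      then have Cs: "C \<in> sets lebesgue" "C \<subseteq> ?Q" using D by auto
      have "P C" using C by (auto simp: \<D>_def elim: stopping_cubesE)
      then have "ennreal (\<mu> * measure lebesgue C) \<le> ennreal (LINT x:C|lebesgue. F x)"
        by (intro ennreal_leI) (simp add: P_def)
      then show "ennreal \<mu> * emeasure lebesgue C \<le> (\<integral>\<^sup>+x\<in>C. ennreal (F x) \<partial>lebesgue)"
        using nn_integral_eq_set_integral[OF Fi F0 Cs] lam Cs by (simp add: fin ennreal_mult)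
    qed
    also have "\<dots> = (\<integral>\<^sup>+x\<in>\<Union>\<D>. ennreal (F x) \<partial>lebesgue)"
      using D by (intro nn_integral_Union_disjoint[symmetric]) auto
    also have "\<dots> \<le> (\<integral>\<^sup>+x\<in>?Q. ennreal (F x) \<partial>lebesgue)"
      using UQ by (intro nn_integral_mono) (auto simp: indicator_def)
    also have "\<dots> = ennreal (\<mu> / 2 * measure lebesgue ?Q)"
      using nn_integral_eq_set_integral[OF Fi F0, of ?Q] by (simp add: lamQ)
    finally have "ennreal (\<mu> * measure lebesgue (\<Union>\<D>)) \<le> ennreal (\<mu> / 2 * measure lebesgue ?Q)"
      using lam UQ U by (simp add: fin ennreal_mult)
    then have "\<mu> * measure lebesgue (\<Union>\<D>) \<le> \<mu> * (measure lebesgue ?Q / 2)"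
      using lam by (simp add: ennreal_le_iff)
    then show ?thesis using lam by simp
  qed
  then show "half_packing lebesgue ?Q \<D>" using D by (simp add: half_packing_def)
  show "AE x in lebesgue. x \<in> ?Q - \<Union>\<D> \<longrightarrow> F x \<le> \<mu>"
  proof (rule AE_le_of_dyadic_averages[OF l Fm])
    show "?Q - \<Union>\<D> \<in> sets lebesgue" using U by auto
    fix x m assume x: "x \<in> ?Q - \<Union>\<D>"
    then have "\<not> P (dyadic a l m x)" using Union_stopping_cubes[of x a l P m] by (auto simp: \<D>_def)
    then have "ennreal (LINT y:dyadic a l m x|lebesgue. F y) \<le> ennreal (\<mu> * measure lebesgue (dyadic a l m x))"
      by (intro ennreal_leI) (simp add: P_def)
    moreover have sub: "dyadic a l m x \<subseteq> ?Q" using x l by (intro dyadic_subset_hcube) auto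
    ultimately show "(\<integral>\<^sup>+y\<in>dyadic a l m x. ennreal (F y) \<partial>lebesgue) \<le> ennreal \<mu> * emeasure lebesgue (dyadic a l m x)"
      using nn_integral_eq_set_integral[OF Fi F0, of "dyadic a l m x"] l lam0 by (simp add: fin ennreal_mult)
  qed (use lam0 in auto)
  fix C assume "C \<in> \<D>"
  then obtain m x where x: "x \<in> ?Q" and C: "C = dyadic a l m x" "P C"
    and min: "\<And>j. j < m \<Longrightarrow> \<not> P (dyadic a l j x)"
    unfolding \<D>_def by (elim stopping_cubesE) auto
  \<comment> \<open>The mean over the whole cube is \<mu>/2, so the root is never selected and every
    selected cube has a parent.\<close>
  have "m \<noteq> 0"
  proof
    assume "m = 0"
    then have "P ?Q" using C dyadic_0[OF l x] by simp
    then show False using lamQ lam0 Qpos by (simp add: P_def) (smt (verit) mult_nonneg_nonneg)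
  qed
  then obtain k where k: "m = Suc k" by (cases m) auto
  have meas: "measure lebesgue (dyadic a l j x) = (l / 2 ^ j) ^ CARD('n)" for j
    using emeasure_dyadic[OF l, of a j x] l by (simp add: measure_def)
  have "ennreal (LINT x:C|lebesgue. F x) \<le> ennreal (LINT x:dyadic a l k x|lebesgue. F x)"
  proof -
    have "C \<subseteq> dyadic a l k x" using dyadic_antimono[of k m a l x] by (simp add: C k)
    moreover have "C \<subseteq> ?Q" "dyadic a l k x \<subseteq> ?Q" "C \<in> sets lebesgue"
      using dyadic_subset_hcube[OF l x] l by (auto simp: C)
    ultimately show ?thesis
      using l by (auto simp flip: nn_integral_eq_set_integral[OF Fi F0] simp: indicator_def intro!: nn_integral_mono)
  qed
  then have "(LINT x:C|lebesgue. F x) \<le> (LINT x:dyadic a l k x|lebesgue. F x)"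
    using INT0 by (simp add: ennreal_le_iff)
  also have "\<dots> \<le> \<mu> * measure lebesgue (dyadic a l k x)" using min[of k] k by (simp add: P_def)
  also have "\<dots> = 2 ^ CARD('n) * \<mu> * measure lebesgue C"
    unfolding C(1) meas k by (simp add: power_divide power_mult_distrib)
  finally show "(LINT x:C|lebesgue. F x) \<le> 2 ^ CARD('n) * \<mu> * measure lebesgue C" .
qed

section \<open>Projection onto polynomials\<close>

lemma finite_multi_idx: "finite (multi_idx k :: ('n::finite \<Rightarrow> nat) set)"
proof (rule finite_subset)
  show "multi_idx k \<subseteq> (UNIV :: 'n set) \<rightarrow>\<^sub>E {..k}"
  proof
    fix \<alpha> :: "'n \<Rightarrow> nat" assume "\<alpha> \<in> multi_idx k"
    then have "sum \<alpha> UNIV \<le> k" by (simp add: multi_idx_def)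
    moreover have "\<alpha> i \<le> sum \<alpha> UNIV" for i by (rule member_le_sum) auto
    ultimately have "\<alpha> i \<le> k" for i using order_trans by blast
    then show "\<alpha> \<in> UNIV \<rightarrow>\<^sub>E {..k}" by auto
  qed
qed (intro finite_PiE; simp)

lemma continuous_on_monom_n [continuous_intros]: "continuous_on S (monom_n \<alpha>)"
  unfolding monom_n_def by (intro continuous_intros)

lemma continuous_on_polys_deg:
  assumes "q \<in> polys_deg k"
  shows "continuous_on S q"
  using assms unfolding polys_deg_def by (auto intro!: continuous_intros)

lemma polys_deg_diff:
  assumes "p \<in> polys_deg k" "q \<in> polys_deg k"
  shows "(\<lambda>x. p x - q x) \<in> polys_deg k"
proof -
  obtain c d where "p = (\<lambda>x. \<Sum>\<alpha>\<in>multi_idx k. c \<alpha> * complex_of_real (monom_n \<alpha> x))"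
    "q = (\<lambda>x. \<Sum>\<alpha>\<in>multi_idx k. d \<alpha> * complex_of_real (monom_n \<alpha> x))"
    using assms by (auto simp: polys_deg_def)
  then have "(\<lambda>x. p x - q x) = (\<lambda>x. \<Sum>\<alpha>\<in>multi_idx k. (c \<alpha> - d \<alpha>) * complex_of_real (monom_n \<alpha> x))"
    by (simp add: sum_subtractf algebra_simps)
  then show ?thesis by (auto simp: polys_deg_def)
qed

lemma one_in_polys_deg: "(\<lambda>x::real^'n::finite. 1) \<in> polys_deg k"
proof -
  define c where "c \<alpha> = (if \<alpha> = (\<lambda>_::'n. 0::nat) then 1 else 0 :: complex)" for \<alpha>
  have "(\<Sum>\<alpha>\<in>multi_idx k. c \<alpha> * complex_of_real (monom_n \<alpha> x)) = 1" for x :: "real^'n"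
  proof -
    have "(\<Sum>\<alpha>\<in>multi_idx k. c \<alpha> * complex_of_real (monom_n \<alpha> x))
        = (\<Sum>\<alpha>\<in>{\<lambda>_. 0}. c \<alpha> * complex_of_real (monom_n \<alpha> x))"
      by (intro sum.mono_neutral_right finite_multi_idx) (auto simp: multi_idx_def c_def)
    then show ?thesis by (simp add: c_def monom_n_def)
  qed
  then show ?thesis unfolding polys_deg_def by (auto intro!: exI[of _ c])
qed

lemma polys_deg_line:
  assumes "q \<in> polys_deg k"
  shows "\<exists>p. \<forall>t::real. q (a + t *\<^sub>R v) = poly p (complex_of_real t)"
proof -
  obtain c where c: "q = (\<lambda>x. \<Sum>\<alpha>\<in>multi_idx k. c \<alpha> * complex_of_real (monom_n \<alpha> x))"
    using assms by (auto simp: polys_deg_def)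
  define p where "p = (\<Sum>\<alpha>\<in>multi_idx k. smult (c \<alpha>)
    (\<Prod>i\<in>UNIV. [: complex_of_real (a $ i), complex_of_real (v $ i) :] ^ \<alpha> i))"
  have "q (a + t *\<^sub>R v) = poly p (complex_of_real t)" for t
    by (simp add: c p_def monom_n_def poly_sum poly_prod)
  then show ?thesis by blast
qed

text \<open>On the line from \<open>a\<close> to \<open>x\<close> the function is a polynomial in
  one variable, vanishing at the infinitely many parameters for which the line is still inside
  \<open>U\<close>; its value at parameter 1 is \<open>q x\<close>.\<close>

lemma polys_deg_eq_0:
  assumes q: "q \<in> polys_deg k" and U: "open U" "a \<in> U" and zero: "\<And>x. x \<in> U \<Longrightarrow> q x = 0"
  shows "q x = 0"
proof -
  obtain p where p: "\<And>t::real. q (a + t *\<^sub>R (x - a)) = poly p (complex_of_real t)"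
    using polys_deg_line[OF q] by blast
  obtain e where e: "e > 0" "ball a e \<subseteq> U" using U by (auto simp: open_contains_ball)
  define d where "d = e / (norm (x - a) + 1)"
  have d: "d > 0" using e by (auto simp: d_def intro!: divide_pos_pos add_nonneg_pos)
  have "poly p (complex_of_real t) = 0" if t: "t \<in> {0<..<d}" for t
  proof -
    have "t * norm (x - a) < e"
    proof -
      have "t * norm (x - a) \<le> t * (norm (x - a) + 1)" using t by (intro mult_left_mono) auto
      also have "\<dots> < d * (norm (x - a) + 1)"
        using t by (intro mult_strict_right_mono) (auto intro: add_nonneg_pos)
      also have "\<dots> = e" unfolding d_def by (simp add: add_nonneg_eq_0_iff)
      finally show ?thesis .
    qed
    then have "a + t *\<^sub>R (x - a) \<in> U" using e t by (intro subsetD[OF e(2)]) (auto simp: dist_norm)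
    then show ?thesis using zero p by metis
  qed
  then have "complex_of_real ` {0<..<d} \<subseteq> {z. poly p z = 0}" by auto
  moreover have "infinite (complex_of_real ` {0<..<d})"
    using d by (subst finite_image_iff) (auto simp: inj_on_def)
  ultimately have "p = 0" using poly_roots_finite[of p] finite_subset by blast
  then show ?thesis using p[of 1] by simp
qed

section \<open>Integrability on bounded sets; existence and uniqueness of the projection\<close>

lemma set_integrable_mult_continuous:
  fixes f :: "'a::euclidean_space \<Rightarrow> 'b::{real_normed_field, second_countable_topology, banach}"
  assumes f: "set_integrable lebesgue R f" and R: "bounded R" and g: "continuous_on UNIV g"
  shows "set_integrable lebesgue R (\<lambda>x. f x * g x)"
proof -
  have "compact (closure R)" using R by (simp add: compact_closure)
  then have "bounded (g ` closure R)"
    using continuous_on_subset[OF g] by (intro compact_imp_bounded compact_continuous_image) auto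
  then obtain C where C: "\<And>x. x \<in> closure R \<Longrightarrow> norm (g x) \<le> C" by (auto simp: bounded_iff)
  have gm: "g \<in> borel_measurable lebesgue"
    using borel_measurable_continuous_onI[OF g] by (simp add: measurable_completion)
  show ?thesis unfolding set_integrable_def
  proof (rule Bochner_Integration.integrable_bound)
    show "integrable lebesgue (\<lambda>x. C * norm (indicator R x *\<^sub>R f x))"
      using f unfolding set_integrable_def by (intro integrable_mult_right integrable_norm)
    have "(\<lambda>x. (indicator R x *\<^sub>R f x) * g x) \<in> borel_measurable lebesgue"
      using borel_measurable_integrable[OF f[unfolded set_integrable_def]] gm by (rule borel_measurable_times)
    then show "(\<lambda>x. indicator R x *\<^sub>R (f x * g x)) \<in> borel_measurable lebesgue" by simp
    show "AE x in lebesgue. norm (indicator R x *\<^sub>R (f x * g x)) \<le> norm (C * norm (indicator R x *\<^sub>R f x))"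
    proof (rule AE_I2)
      fix x
      show "norm (indicator R x *\<^sub>R (f x * g x)) \<le> norm (C * norm (indicator R x *\<^sub>R f x))"
      proof (cases "x \<in> R")
        case True
        then have "norm (g x) \<le> C" using C closure_subset by blast
        then have "norm (f x) * norm (g x) \<le> norm (f x) * \<bar>C\<bar>" by (intro mult_left_mono) auto
        then show ?thesis using True by (simp add: norm_mult mult.commute)
      qed auto
    qed
  qed
qed

lemma set_integrable_continuous_bounded:
  fixes g :: "'a::euclidean_space \<Rightarrow> 'b::{real_normed_field, second_countable_topology, banach}"
  assumes R: "bounded R" "R \<in> sets lebesgue" and g: "continuous_on UNIV g"
  shows "set_integrable lebesgue R g"
proof -
  have "emeasure lebesgue R < \<infinity>"
    using bounded_set_imp_lmeasurable[OF R] fmeasurableD2[of R lebesgue] by (simp only: less_top infinity_ennreal_def)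
  then have "set_integrable lebesgue R (\<lambda>x. 1 :: 'b)"
    using R unfolding set_integrable_def
    by (intro integrable_scaleR_left) (simp add: integrable_real_indicator)
  from set_integrable_mult_continuous[OF this R(1) g] show ?thesis by simp
qed

lemma
  fixes f :: "'i \<Rightarrow> 'a \<Rightarrow> 'b::{banach, second_countable_topology}"
  assumes "\<And>i. i \<in> I \<Longrightarrow> set_integrable M R (f i)"
  shows set_integrable_sum: "set_integrable M R (\<lambda>x. \<Sum>i\<in>I. f i x)"
    and set_integral_sum: "(LINT x:R|M. \<Sum>i\<in>I. f i x) = (\<Sum>i\<in>I. LINT x:R|M. f i x)"
  using assms by (simp_all add: set_integrable_def set_lebesgue_integral_def scaleR_sum_right)

text \<open>Gram--Schmidt with no linear independence assumed. The induction is for all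
  \<open>f\<close> simultaneously because the hypothesis is used twice: for \<open>f\<close> and for
  the new function \<open>m \<gamma>\<close>, whose residual \<open>h\<close> is the new
  direction.\<close>

lemma exists_orthogonal_combination:
  fixes m :: "'i \<Rightarrow> real^'n::finite \<Rightarrow> real"
  assumes R: "bounded R" "R \<in> sets lebesgue" and A: "finite A"
    and m: "\<And>\<alpha>. continuous_on UNIV (m \<alpha>)" and f: "set_integrable lebesgue R f"
  shows "\<exists>c. \<forall>\<alpha>\<in>A. (LINT x:R|lebesgue. (f x - (\<Sum>\<beta>\<in>A. c \<beta> * m \<beta> x)) * m \<alpha> x) = 0"
  using A f
proof (induction A arbitrary: f rule: finite_induct)
  case empty
  show ?case by simp
next
  case (insert \<gamma> A)
  have int: "set_integrable lebesgue R (\<lambda>x. g x * h x)"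
    if "set_integrable lebesgue R g" "continuous_on UNIV h" for g h :: "real^'n \<Rightarrow> real"
    using that R by (intro set_integrable_mult_continuous)
  have cont_int: "set_integrable lebesgue R g" if "continuous_on UNIV g" for g :: "real^'n \<Rightarrow> real"
    using R that by (intro set_integrable_continuous_bounded)
  obtain d where d: "\<And>\<alpha>. \<alpha> \<in> A \<Longrightarrow> (LINT x:R|lebesgue. (m \<gamma> x - (\<Sum>\<beta>\<in>A. d \<beta> * m \<beta> x)) * m \<alpha> x) = 0"
    using insert.IH[OF cont_int[OF m]] by blast
  obtain c where c: "\<And>\<alpha>. \<alpha> \<in> A \<Longrightarrow> (LINT x:R|lebesgue. (f x - (\<Sum>\<beta>\<in>A. c \<beta> * m \<beta> x)) * m \<alpha> x) = 0"
    using insert.IH[OF insert.prems] by blast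
  define h where "h x = m \<gamma> x - (\<Sum>\<beta>\<in>A. d \<beta> * m \<beta> x)" for x
  define g where "g x = f x - (\<Sum>\<beta>\<in>A. c \<beta> * m \<beta> x)" for x
  have hc: "continuous_on UNIV h" unfolding h_def by (intro continuous_intros m)
  have gi: "set_integrable lebesgue R g"
    unfolding g_def by (intro set_integral_diff insert.prems cont_int continuous_intros m)
  define N where "N = (LINT x:R|lebesgue. h x * h x)"
  \<comment> \<open>one Gram--Schmidt step; if \<open>N = 0\<close> then \<open>h = 0\<close> almost everywhere on \<open>R\<close> and \<open>t = 0\<close> will do\<close>
  define t where "t = (LINT x:R|lebesgue. g x * h x) / N"
  have tN: "(LINT x:R|lebesgue. g x * h x) = t * N"
  proof (cases "N = 0")
    case True
    have "integrable lebesgue (\<lambda>x. indicator R x *\<^sub>R (h x * h x))"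
      using int[OF cont_int[OF hc] hc] by (simp add: set_integrable_def)
    then have "AE x in lebesgue. indicator R x *\<^sub>R (h x * h x) = 0"
      using True unfolding N_def set_lebesgue_integral_def
      by (subst (asm) integral_nonneg_eq_0_iff_AE) auto
    then have "AE x in lebesgue. indicator R x *\<^sub>R (g x * h x) = 0"
      by eventually_elim (auto split: split_indicator)
    then have "(LINT x:R|lebesgue. g x * h x) = 0"
      unfolding set_lebesgue_integral_def by (rule integral_eq_zero_AE)
    then show ?thesis using True by simp
  qed (simp add: t_def)
  define G where "G x = g x - t * h x" for x
  have Gi: "set_integrable lebesgue R G"
    unfolding G_def by (intro set_integral_diff gi set_integrable_mult_right cont_int hc)
  have G: "(LINT x:R|lebesgue. G x * u x) = (LINT x:R|lebesgue. g x * u x) - t * (LINT x:R|lebesgue. h x * u x)"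
    if "continuous_on UNIV u" for u
  proof -
    have "(LINT x:R|lebesgue. G x * u x) = (LINT x:R|lebesgue. g x * u x - t * (h x * u x))"
      by (simp add: G_def algebra_simps)
    also have "\<dots> = (LINT x:R|lebesgue. g x * u x) - (LINT x:R|lebesgue. t * (h x * u x))"
      by (intro set_integral_diff set_integrable_mult_right int gi cont_int hc that)
    finally show ?thesis by simp
  qed
  have GA: "(LINT x:R|lebesgue. G x * m \<alpha> x) = 0" if "\<alpha> \<in> A" for \<alpha>
    using G[OF m] c[OF that] d[OF that] by (simp add: g_def h_def)
  \<comment> \<open>Since \<open>m \<gamma>\<close> is \<open>h\<close> plus a combination of the
    functions indexed by \<open>A\<close>, orthogonality to those and to \<open>h\<close>
    suffices.\<close>
  have G\<gamma>: "(LINT x:R|lebesgue. G x * m \<gamma> x) = 0"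
  proof -
    have "(LINT x:R|lebesgue. G x * m \<gamma> x) = (LINT x:R|lebesgue. G x * h x + (\<Sum>\<beta>\<in>A. d \<beta> * (G x * m \<beta> x)))"
      by (simp add: h_def algebra_simps sum_distrib_left)
    also have "\<dots> = (LINT x:R|lebesgue. G x * h x) + (LINT x:R|lebesgue. (\<Sum>\<beta>\<in>A. d \<beta> * (G x * m \<beta> x)))"
      by (intro set_integral_add set_integrable_sum set_integrable_mult_right int Gi hc m)
    also have "(LINT x:R|lebesgue. (\<Sum>\<beta>\<in>A. d \<beta> * (G x * m \<beta> x))) = (\<Sum>\<beta>\<in>A. LINT x:R|lebesgue. d \<beta> * (G x * m \<beta> x))"
      by (intro set_integral_sum set_integrable_mult_right int Gi m)
    also have "\<dots> = 0" using GA by simp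
    also have "(LINT x:R|lebesgue. G x * h x) = 0" using G[OF hc] tN by (simp add: N_def)
    finally show ?thesis by simp
  qed
  define c' where "c' \<beta> = (if \<beta> = \<gamma> then t else c \<beta> - t * d \<beta>)" for \<beta>
  have "f x - (\<Sum>\<beta>\<in>insert \<gamma> A. c' \<beta> * m \<beta> x) = G x" for x
  proof -
    have "(\<Sum>\<beta>\<in>A. c' \<beta> * m \<beta> x) = (\<Sum>\<beta>\<in>A. c \<beta> * m \<beta> x) - t * (\<Sum>\<beta>\<in>A. d \<beta> * m \<beta> x)"
      unfolding sum_distrib_left sum_subtractf[symmetric]
      using insert.hyps by (intro sum.cong) (auto simp: c'_def algebra_simps)
    then show ?thesis using insert.hyps by (simp add: G_def g_def h_def c'_def algebra_simps)
  qed
  then have "\<forall>\<alpha>\<in>insert \<gamma> A. (LINT x:R|lebesgue. (f x - (\<Sum>\<beta>\<in>insert \<gamma> A. c' \<beta> * m \<beta> x)) * m \<alpha> x) = 0"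
    using GA G\<gamma> by simp
  then show ?case by blast
qed

lemma set_integral_sum_complex:
  fixes u v :: "'a \<Rightarrow> real"
  assumes "set_integrable M R u" "set_integrable M R v"
  shows "(LINT x:R|M. complex_of_real (u x) + \<i> * complex_of_real (v x))
    = complex_of_real (LINT x:R|M. u x) + \<i> * complex_of_real (LINT x:R|M. v x)"
proof -
  have "set_integrable M R (\<lambda>x. complex_of_real (u x))" "set_integrable M R (\<lambda>x. complex_of_real (v x))"
    using assms unfolding set_integrable_def
    by (auto dest!: integrable_of_real[where ?'a = complex] simp: scaleR_conv_of_real)
  then show ?thesis by (simp add: set_integral_complex_of_real)
qed

text \<open>The monomials are real, so real and imaginary parts can be projected separately.\<close>

lemma exists_projection:
  fixes f :: "real^'n::finite \<Rightarrow> complex"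
  assumes R: "bounded R" "R \<in> sets lebesgue" and f: "set_integrable lebesgue R f"
  shows "\<exists>q\<in>polys_deg k. \<forall>\<alpha>\<in>multi_idx k. (LINT x:R|lebesgue. (f x - q x) * complex_of_real (monom_n \<alpha> x)) = 0"
proof -
  let ?A = "multi_idx k :: ('n \<Rightarrow> nat) set"
  have fRe: "set_integrable lebesgue R (\<lambda>x. Re (f x))" and fIm: "set_integrable lebesgue R (\<lambda>x. Im (f x))"
    using integrable_Re[OF f[unfolded set_integrable_def]] integrable_Im[OF f[unfolded set_integrable_def]]
    by (simp_all add: set_integrable_def)
  obtain c where c: "\<And>\<alpha>. \<alpha> \<in> ?A \<Longrightarrow>
      (LINT x:R|lebesgue. (Re (f x) - (\<Sum>\<beta>\<in>?A. c \<beta> * monom_n \<beta> x)) * monom_n \<alpha> x) = 0"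
    using exists_orthogonal_combination[OF R, of ?A monom_n, OF finite_multi_idx continuous_on_monom_n fRe] by blast
  obtain d where d: "\<And>\<alpha>. \<alpha> \<in> ?A \<Longrightarrow>
      (LINT x:R|lebesgue. (Im (f x) - (\<Sum>\<beta>\<in>?A. d \<beta> * monom_n \<beta> x)) * monom_n \<alpha> x) = 0"
    using exists_orthogonal_combination[OF R, of ?A monom_n, OF finite_multi_idx continuous_on_monom_n fIm] by blast
  define u where "u x = Re (f x) - (\<Sum>\<beta>\<in>?A. c \<beta> * monom_n \<beta> x)" for x
  define v where "v x = Im (f x) - (\<Sum>\<beta>\<in>?A. d \<beta> * monom_n \<beta> x)" for x
  define q where "q x = (\<Sum>\<alpha>\<in>?A. (complex_of_real (c \<alpha>) + \<i> * complex_of_real (d \<alpha>)) * complex_of_real (monom_n \<alpha> x))" for x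
  have q: "q \<in> polys_deg k" unfolding polys_deg_def mem_Collect_eq q_def[abs_def]
    by (rule exI[of _ "\<lambda>\<alpha>. complex_of_real (c \<alpha>) + \<i> * complex_of_real (d \<alpha>)"]) (rule refl)
  have cont_int: "set_integrable lebesgue R g" if "continuous_on UNIV g" for g :: "real^'n \<Rightarrow> real"
    using R that by (intro set_integrable_continuous_bounded)
  have ui: "set_integrable lebesgue R u" unfolding u_def
    by (intro set_integral_diff fRe cont_int continuous_intros)
  have vi: "set_integrable lebesgue R v" unfolding v_def
    by (intro set_integral_diff fIm cont_int continuous_intros)
  have fq: "f x - q x = complex_of_real (u x) + \<i> * complex_of_real (v x)" for x
  proof -
    have "q x = complex_of_real (\<Sum>\<beta>\<in>?A. c \<beta> * monom_n \<beta> x) + \<i> * complex_of_real (\<Sum>\<beta>\<in>?A. d \<beta> * monom_n \<beta> x)"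
      by (simp add: q_def sum.distrib sum_distrib_left algebra_simps)
    then show ?thesis by (simp add: u_def v_def complex_eq_iff)
  qed
  have "(LINT x:R|lebesgue. (f x - q x) * complex_of_real (monom_n \<alpha> x)) = 0" if "\<alpha> \<in> ?A" for \<alpha>
  proof -
    have "(LINT x:R|lebesgue. (f x - q x) * complex_of_real (monom_n \<alpha> x))
      = (LINT x:R|lebesgue. complex_of_real (u x * monom_n \<alpha> x) + \<i> * complex_of_real (v x * monom_n \<alpha> x))"
      by (simp add: fq algebra_simps)
    also have "\<dots> = complex_of_real (LINT x:R|lebesgue. u x * monom_n \<alpha> x)
        + \<i> * complex_of_real (LINT x:R|lebesgue. v x * monom_n \<alpha> x)"
      by (intro set_integral_sum_complex set_integrable_mult_continuous ui vi R continuous_on_monom_n)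
    also have "\<dots> = 0" using c[OF that] d[OF that] by (simp add: u_def v_def)
    finally show ?thesis .
  qed
  with q show ?thesis by blast
qed

text \<open>The conjugate of \<open>q\<close> is again a combination of the real monomials, so
  \<open>q\<close> may be tested against it. The integral of |q|^2 then vanishes, continuity gives q
  = 0 on the interior, and the identity theorem extends this everywhere.\<close>

lemma polys_deg_orthogonal_eq_0:
  fixes q :: "real^'n::finite \<Rightarrow> complex"
  assumes R: "bounded R" "R \<in> sets lebesgue" "interior R \<noteq> {}" and q: "q \<in> polys_deg k"
    and orth: "\<And>\<alpha>. \<alpha> \<in> multi_idx k \<Longrightarrow> (LINT x:R|lebesgue. q x * complex_of_real (monom_n \<alpha> x)) = 0"
  shows "q x = 0"
proof -
  let ?A = "multi_idx k :: ('n \<Rightarrow> nat) set"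
  obtain c where c: "q = (\<lambda>x. \<Sum>\<alpha>\<in>?A. c \<alpha> * complex_of_real (monom_n \<alpha> x))"
    using q by (auto simp: polys_deg_def)
  have qc: "continuous_on UNIV q" using q by (rule continuous_on_polys_deg)
  have one: "set_integrable lebesgue R (\<lambda>x. 1 :: complex)"
    using R by (intro set_integrable_continuous_bounded continuous_intros)
  have ci: "set_integrable lebesgue R g" if "continuous_on UNIV g" for g :: "real^'n \<Rightarrow> complex"
    using set_integrable_mult_continuous[OF one R(1) that] by simp
  have "(LINT x:R|lebesgue. q x * cnj (q x))
      = (LINT x:R|lebesgue. (\<Sum>\<alpha>\<in>?A. cnj (c \<alpha>) * (q x * complex_of_real (monom_n \<alpha> x))))"
    by (intro arg_cong[where f = "set_lebesgue_integral lebesgue R"] ext)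
       (subst (2) c, simp add: sum_distrib_left algebra_simps)
  also have "\<dots> = (\<Sum>\<alpha>\<in>?A. LINT x:R|lebesgue. cnj (c \<alpha>) * (q x * complex_of_real (monom_n \<alpha> x)))"
    by (intro set_integral_sum ci continuous_intros qc)
  also have "\<dots> = 0" using orth by simp
  finally have z: "(LINT x:R|lebesgue. complex_of_real ((cmod (q x))\<^sup>2)) = 0"
    by (simp only: complex_norm_square)
  have "complex_of_real (LINT x:R|lebesgue. (cmod (q x))\<^sup>2) = 0"
    using z by (simp only: set_integral_complex_of_real)
  then have z: "(LINT x:R|lebesgue. (cmod (q x))\<^sup>2) = 0" by simp
  have "set_integrable lebesgue R (\<lambda>x. 1 * (cmod (q x))\<^sup>2)"
  proof (rule set_integrable_mult_continuous)
    show "set_integrable lebesgue R (\<lambda>x. 1::real)"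
      using set_integrable_norm[OF one] by simp
    show "continuous_on UNIV (\<lambda>x. (cmod (q x))\<^sup>2)" by (intro continuous_intros qc)
  qed (rule R)
  then have "AE x in lebesgue. indicator R x *\<^sub>R (cmod (q x))\<^sup>2 = 0"
    using z unfolding set_lebesgue_integral_def set_integrable_def
    by (subst (asm) integral_nonneg_eq_0_iff_AE) auto
  then have AE: "AE x in lebesgue. x \<notin> {x \<in> interior R. q x \<noteq> 0}"
    by eventually_elim (use interior_subset in \<open>auto simp: indicator_def split: if_splits\<close>)
  have op: "open {x \<in> interior R. q x \<noteq> 0}"
  proof -
    have "{x \<in> interior R. q x \<noteq> 0} = interior R \<inter> (q -` (- {0}))" by auto
    moreover have "open (q -` (- {0}))" using qc by (intro open_vimage) auto
    ultimately show ?thesis by (simp add: open_Int)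
  qed
  have "negligible {x \<in> interior R. q x \<noteq> 0}"
    unfolding negligible_iff_null_sets using AE op
    by (subst (asm) AE_iff_null_sets[symmetric]) auto
  then have "{x \<in> interior R. q x \<noteq> 0} = {}" using open_not_negligible[OF op] by blast
  then have zero: "q y = 0" if "y \<in> interior R" for y using that by blast
  obtain a where "a \<in> interior R" using R(3) by blast
  from polys_deg_eq_0[OF q open_interior this zero] show ?thesis .
qed

text \<open>The difference of two candidates is a polynomial orthogonal to all monomials, hence
  zero. Identities between projections thus reduce to checking orthogonality.\<close>

lemma proj_poly_eqI:
  fixes f :: "real^'n::finite \<Rightarrow> complex"
  assumes R: "bounded R" "R \<in> sets lebesgue" "interior R \<noteq> {}" and f: "set_integrable lebesgue R f"
    and q: "q \<in> polys_deg k"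
    and orth: "\<And>\<alpha>. \<alpha> \<in> multi_idx k \<Longrightarrow> (LINT x:R|lebesgue. (f x - q x) * complex_of_real (monom_n \<alpha> x)) = 0"
  shows "proj_poly k R f = q"
  unfolding proj_poly_def
proof (rule the_equality)
  fix p assume p: "p \<in> polys_deg k \<and> (\<forall>\<alpha>\<in>multi_idx k.
    (LINT x:R|lebesgue. (f x - p x) * complex_of_real (monom_n \<alpha> x)) = 0)"
  have int: "set_integrable lebesgue R (\<lambda>x. (f x - u x) * complex_of_real (monom_n \<alpha> x))"
    if "u \<in> polys_deg k" for u \<alpha>
  proof (intro set_integrable_mult_continuous set_integral_diff f R continuous_intros)
    show "set_integrable lebesgue R u"
      by (intro set_integrable_continuous_bounded R continuous_on_polys_deg[OF that])
  qed
  have "q x - p x = 0" for x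
  proof (rule polys_deg_orthogonal_eq_0[OF R polys_deg_diff[OF q]])
    show "p \<in> polys_deg k" using p by blast
    fix \<alpha> assume \<alpha>: "\<alpha> \<in> (multi_idx k :: ('n \<Rightarrow> nat) set)"
    have "(LINT x:R|lebesgue. (q x - p x) * complex_of_real (monom_n \<alpha> x))
      = (LINT x:R|lebesgue. (f x - p x) * complex_of_real (monom_n \<alpha> x)
         - (f x - q x) * complex_of_real (monom_n \<alpha> x))"
      by (simp add: algebra_simps)
    also have "\<dots> = 0" using p \<alpha> orth[OF \<alpha>] int[OF q] int[of p]
      by (subst set_integral_diff(2)) auto
    finally show "(LINT x:R|lebesgue. (q x - p x) * complex_of_real (monom_n \<alpha> x)) = 0" .
  qed
  then show "p = q" by (auto simp: fun_eq_iff)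
qed (use q orth in auto)

lemma
  fixes f :: "real^'n::finite \<Rightarrow> complex"
  assumes R: "bounded R" "R \<in> sets lebesgue" "interior R \<noteq> {}" and f: "set_integrable lebesgue R f"
  shows proj_poly_in_polys_deg: "proj_poly k R f \<in> polys_deg k"
    and proj_poly_orthogonal: "\<And>\<alpha>. \<alpha> \<in> multi_idx k \<Longrightarrow>
      (LINT x:R|lebesgue. (f x - proj_poly k R f x) * complex_of_real (monom_n \<alpha> x)) = 0"
proof -
  obtain q where q: "q \<in> polys_deg k"
    "\<And>\<alpha>. \<alpha> \<in> multi_idx k \<Longrightarrow> (LINT x:R|lebesgue. (f x - q x) * complex_of_real (monom_n \<alpha> x)) = 0"
    using exists_projection[OF R(1,2) f] by blast
  then have "proj_poly k R f = q" by (intro proj_poly_eqI[OF R f])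
  then show "proj_poly k R f \<in> polys_deg k" and "\<And>\<alpha>. \<alpha> \<in> multi_idx k \<Longrightarrow>
      (LINT x:R|lebesgue. (f x - proj_poly k R f x) * complex_of_real (monom_n \<alpha> x)) = 0"
    using q by auto
qed

section \<open>Local integrability\<close>

lemma locally_integrable_measurable:
  fixes f :: "real^'n::finite \<Rightarrow> 'b::{banach, second_countable_topology}"
  assumes "locally_integrable f"
  shows "f \<in> borel_measurable lebesgue"
proof (rule borel_measurable_LIMSEQ_metric)
  show "(\<lambda>x. indicator (cball 0 (real n)) x *\<^sub>R f x) \<in> borel_measurable lebesgue" for n
    using assms unfolding locally_integrable_def set_integrable_def
    by (intro borel_measurable_integrable) simp
  fix x :: "real^'n"
  obtain N where N: "norm x \<le> real N" using real_arch_simple by blast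
  have "eventually (\<lambda>n. indicator (cball 0 (real n)) x *\<^sub>R f x = f x) sequentially"
    using eventually_ge_at_top[of N] by eventually_elim (use N in auto)
  then show "(\<lambda>n. indicator (cball 0 (real n)) x *\<^sub>R f x) \<longlonglongrightarrow> f x"
    by (rule tendsto_eventually)
qed

lemma locally_integrable_bounded:
  assumes "locally_integrable f" "bounded R" "R \<in> sets lebesgue"
  shows "set_integrable lebesgue R f"
proof (rule set_integrable_subset)
  show "set_integrable lebesgue (closure R) f"
    using assms by (simp add: locally_integrable_def compact_closure)
qed (use assms closure_subset in auto)

lemma locally_integrable_diff_polys_deg:
  assumes f: "locally_integrable f" and q: "q \<in> polys_deg k"
  shows "locally_integrable (\<lambda>x. f x - q x)"
  unfolding locally_integrable_def
proof (intro allI impI)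
  fix K :: "(real^'a) set" assume K: "compact K"
  then have "K \<in> sets lebesgue" by (simp add: borel_compact sets_completionI_sets)
  then have "set_integrable lebesgue K q"
    using K by (intro set_integrable_continuous_bounded compact_imp_bounded continuous_on_polys_deg[OF q])
  moreover have "set_integrable lebesgue K f" using f K by (simp add: locally_integrable_def)
  ultimately show "set_integrable lebesgue K (\<lambda>x. f x - q x)" by (intro set_integral_diff)
qed

section \<open>Oscillations\<close>

lemma bounded_hcube: "bounded (hcube a l)"
  using hcube_subset_cbox bounded_cbox bounded_subset by blast

lemma interior_hcube_nonempty:
  assumes "l > 0"
  shows "interior (hcube a l) \<noteq> {}"
proof -
  have "box a (a + l *\<^sub>R One) \<subseteq> interior (hcube a l)"
    using box_subset_hcube open_box by (rule interior_maximal)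
  moreover have "box a (a + l *\<^sub>R One) \<noteq> {}"
    using assms by (simp add: box_ne_empty inner_add_left inner_sum_left_Basis)
  ultimately show ?thesis by blast
qed

lemma hcubesD:
  assumes "R \<in> hcubes"
  shows "bounded R" "R \<in> sets lebesgue" "interior R \<noteq> {}"
    "emeasure lebesgue R < \<infinity>" "0 < measure lebesgue R"
  using assms bounded_hcube interior_hcube_nonempty
  by (auto simp: hcubes_def emeasure_hcube measure_hcube)

text \<open>Pairs a half-open cube, as the decomposition produces it, with the closed cube of the
  hypotheses. They differ by a null set, so averages and projections agree.\<close>

definition closed_cube_of :: "(real^'n::finite) set \<Rightarrow> (real^'n) set \<Rightarrow> bool" where
  "closed_cube_of R C \<longleftrightarrow> (\<exists>a l. l > 0 \<and> R = hcube a l \<and> C = cbox a (a + l *\<^sub>R One))"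

lemma hcubes_closed_cube: "R \<in> hcubes \<Longrightarrow> \<exists>C. closed_cube_of R C"
  by (auto simp: hcubes_def closed_cube_of_def)

lemma is_cube_hcube: "is_cube C \<Longrightarrow> \<exists>R. closed_cube_of R C"
  by (auto simp: is_cube_def closed_cube_of_def)

lemma closed_cube_ofD:
  assumes "closed_cube_of R C"
  shows "R \<in> hcubes" "is_cube C" "R \<subseteq> C" "AE x in lebesgue. x \<in> R \<longleftrightarrow> x \<in> C" "compact C" "C \<in> sets lebesgue"
proof -
  obtain a l where al: "l > 0" "R = hcube a l" "C = cbox a (a + l *\<^sub>R One)"
    using assms by (auto simp: closed_cube_of_def)
  show "R \<in> hcubes" "is_cube C" using al by (auto simp: hcubes_def is_cube_def)
  show "R \<subseteq> C" unfolding al by (rule hcube_subset_cbox)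
  show "AE x in lebesgue. x \<in> R \<longleftrightarrow> x \<in> C" unfolding al by (rule AE_hcube_iff_cbox)
  show "compact C" "C \<in> sets lebesgue" unfolding al by simp_all
qed

lemma set_integral_closed_cube:
  fixes g :: "real^'n::finite \<Rightarrow> 'b::{banach, second_countable_topology}"
  assumes R: "closed_cube_of R C" and g: "g \<in> borel_measurable lebesgue"
  shows "(LINT x:C|lebesgue. g x) = (LINT x:R|lebesgue. g x)"
  using closed_cube_ofD[OF R] hcubesD(2)[OF closed_cube_ofD(1)[OF R]] g
  by (intro set_integral_cong_set) (auto simp: set_borel_measurable_def)

lemma measure_closed_cube:
  assumes "closed_cube_of R C"
  shows "measure lebesgue C = measure lebesgue R"
  using closed_cube_ofD[OF assms] hcubesD(2)[OF closed_cube_ofD(1)[OF assms]]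
  by (intro measure_eq_AE) auto

lemma avg_closed_cube:
  assumes "closed_cube_of R C" "g \<in> borel_measurable lebesgue"
  shows "avg C g = avg R g"
  unfolding avg_def set_integral_closed_cube[OF assms] measure_closed_cube[OF assms(1)] ..

lemma measurable_polys_deg: "q \<in> polys_deg k \<Longrightarrow> q \<in> borel_measurable lebesgue"
  using borel_measurable_continuous_onI[OF continuous_on_polys_deg[of q k UNIV]]
  by (simp add: measurable_completion)

lemma measurable_monom_n: "monom_n \<alpha> \<in> borel_measurable lebesgue"
  using borel_measurable_continuous_onI[OF continuous_on_monom_n[of UNIV \<alpha>]]
  by (simp add: measurable_completion)

lemma closed_cube_interior:
  assumes "closed_cube_of R C"
  shows "interior C \<noteq> {}"
  using hcubesD(3)[OF closed_cube_ofD(1)[OF assms]] interior_mono[OF closed_cube_ofD(3)[OF assms]] by auto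

lemma proj_poly_closed_cube:
  fixes f :: "real^'n::finite \<Rightarrow> complex"
  assumes R: "closed_cube_of R C" and f: "locally_integrable f"
  shows "proj_poly k R f = proj_poly k C f"
proof -
  note RC = closed_cube_ofD[OF R]
  note RD = hcubesD[OF RC(1)]
  have fC: "set_integrable lebesgue C f" using f RC(5) by (simp add: locally_integrable_def)
  have P: "proj_poly k C f \<in> polys_deg k"
    using RC by (intro proj_poly_in_polys_deg compact_imp_bounded closed_cube_interior[OF R] fC)
  show ?thesis
  proof (rule proj_poly_eqI[OF RD(1-3) locally_integrable_bounded[OF f RD(1,2)] P])
    fix \<alpha> assume \<alpha>: "\<alpha> \<in> (multi_idx k :: ('n \<Rightarrow> nat) set)"
    have "(\<lambda>x. (f x - proj_poly k C f x) * complex_of_real (monom_n \<alpha> x)) \<in> borel_measurable lebesgue"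
      using locally_integrable_measurable[OF f] measurable_polys_deg[OF P] measurable_monom_n[of \<alpha>]
      by measurable
    from set_integral_closed_cube[OF R this]
    show "(LINT x:R|lebesgue. (f x - proj_poly k C f x) * complex_of_real (monom_n \<alpha> x)) = 0"
      using proj_poly_orthogonal[OF compact_imp_bounded[OF RC(5)] RC(6) closed_cube_interior[OF R] fC \<alpha>] by simp
  qed
qed

lemma proj_poly_polys_deg_hcube:
  assumes "R \<in> hcubes" "locally_integrable f"
  shows "proj_poly k R f \<in> polys_deg k"
  using hcubesD[OF assms(1)] locally_integrable_bounded[OF assms(2)]
  by (intro proj_poly_in_polys_deg) auto

lemma set_integral_pos:
  fixes h :: "'a \<Rightarrow> real"
  assumes "set_integrable M R h" "\<And>x. 0 \<le> h x" "AE x in M. 0 < h x" "R \<in> sets M" "0 < measure M R"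
  shows "0 < (LINT x:R|M. h x)"
proof (rule ccontr)
  have nn: "0 \<le> (LINT x:R|M. h x)"
    unfolding set_lebesgue_integral_def using assms(2) by (intro integral_nonneg_AE) auto
  assume "\<not> 0 < (LINT x:R|M. h x)"
  with nn have "(LINT x:R|M. h x) = 0" by simp
  then have "AE x in M. indicator R x *\<^sub>R h x = 0"
    using assms(1,2) unfolding set_lebesgue_integral_def set_integrable_def
    by (subst (asm) integral_nonneg_eq_0_iff_AE) auto
  with assms(3) have "AE x in M. x \<notin> R"
    by eventually_elim (auto simp: indicator_def split: if_splits)
  then have "R \<in> null_sets M" using assms(4) by (simp add: AE_iff_null_sets)
  then show False using assms(5) by (simp add: measure_eq_0_null_sets)
qed

lemma proj_poly_bound_hcube:
  fixes \<gamma> :: real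
  assumes \<gamma>: "\<And>(C::(real^'n::finite) set) g x. is_cube C \<Longrightarrow> set_integrable lebesgue C g \<Longrightarrow> x \<in> C \<Longrightarrow>
      cmod (proj_poly k C g x) \<le> \<gamma> * avg C (\<lambda>y. cmod (g y))"
    and R: "(R :: (real^'n) set) \<in> hcubes" and g: "locally_integrable g" and x: "x \<in> R"
  shows "cmod (proj_poly k R g x) \<le> \<gamma> * avg R (\<lambda>y. cmod (g y))"
proof -
  obtain C where C: "closed_cube_of R C" using hcubes_closed_cube[OF R] by blast
  note CD = closed_cube_ofD[OF C]
  have gm: "(\<lambda>y. cmod (g y)) \<in> borel_measurable lebesgue"
    using locally_integrable_measurable[OF g] by measurable
  have "set_integrable lebesgue C g" using g CD(5) by (simp add: locally_integrable_def)
  from \<gamma>[OF CD(2) this, of x] x CD(3) show ?thesis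
    unfolding proj_poly_closed_cube[OF C g] avg_closed_cube[OF C gm] by blast
qed

text \<open>Constants are their own projections, so testing with the function 1 forces this. It
  allows one \<alpha> containing \<gamma> to serve also off the packing.\<close>

lemma projection_constant_ge_1:
  fixes \<gamma> :: real
  assumes \<gamma>: "\<And>(C::(real^'n::finite) set) g x. is_cube C \<Longrightarrow> set_integrable lebesgue C g \<Longrightarrow> x \<in> C \<Longrightarrow>
      cmod (proj_poly k C g x) \<le> \<gamma> * avg C (\<lambda>y. cmod (g y))"
    and R: "(R :: (real^'n) set) \<in> hcubes"
  shows "1 \<le> \<gamma>"
proof -
  note RD = hcubesD[OF R]
  have li: "locally_integrable (\<lambda>x::real^'n. 1 :: complex)"
    unfolding locally_integrable_def
    by (auto intro!: set_integrable_continuous_bounded compact_imp_bounded borel_compact sets_completionI_sets continuous_intros)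
  have P: "proj_poly k R (\<lambda>x. 1) = (\<lambda>x. 1)"
    by (rule proj_poly_eqI[OF RD(1-3) locally_integrable_bounded[OF li RD(1,2)] one_in_polys_deg]) simp
  obtain x where "x \<in> R" using RD(5) by fastforce
  from proj_poly_bound_hcube[OF \<gamma> R li this] have "1 \<le> \<gamma> * avg R (\<lambda>y. 1)" by (simp add: P)
  also have "avg R (\<lambda>y. 1) = 1" using RD by (simp add: avg_def set_lebesgue_integral_def)
  finally show ?thesis by simp
qed

text \<open>Off the packing twice the mean would suffice; the factor 2^n \<gamma> is paid on a cube
  \<open>D\<close>, where P_D f - P_R f is bounded by \<gamma> times the average of F_R over
  \<open>D\<close>, and that average is at most 2^n times the threshold.\<close>

lemma oscillation_packing:
  fixes f :: "real^'n::finite \<Rightarrow> complex" and \<gamma> :: real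
  assumes f: "locally_integrable f"
    and \<gamma>: "\<And>(C::(real^'n) set) g x. is_cube C \<Longrightarrow> set_integrable lebesgue C g \<Longrightarrow> x \<in> C \<Longrightarrow>
      cmod (proj_poly k C g x) \<le> \<gamma> * avg C (\<lambda>y. cmod (g y))"
    and R: "R \<in> hcubes"
  defines "F \<equiv> \<lambda>R x. cmod (f x - proj_poly k R f x)"
  shows "\<exists>\<D>\<subseteq>hcubes. half_packing lebesgue R \<D>
    \<and> (AE x in lebesgue. x \<in> R - \<Union>\<D> \<longrightarrow> F R x \<le> 2 * 2 ^ CARD('n) * \<gamma> * avg R (F R))
    \<and> (\<forall>D\<in>\<D>. AE x in lebesgue. x \<in> D \<longrightarrow> F R x \<le> 2 * 2 ^ CARD('n) * \<gamma> * avg R (F R) + F D x)"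
proof -
  define q where "q = proj_poly k R f"
  have q: "q \<in> polys_deg k" unfolding q_def by (rule proj_poly_polys_deg_hcube[OF R f])
  define g where "g x = f x - q x" for x
  have g: "locally_integrable g" unfolding g_def by (rule locally_integrable_diff_polys_deg[OF f q])
  have FR: "F R = (\<lambda>x. cmod (g x))" by (simp add: F_def g_def q_def)
  have gm: "g \<in> borel_measurable lebesgue" by (rule locally_integrable_measurable[OF g])
  obtain a l where al: "l > 0" "R = hcube a l" using R by (auto simp: hcubes_def)
  have Fi: "set_integrable lebesgue R (F R)"
    unfolding FR using locally_integrable_bounded[OF g hcubesD(1,2)[OF R]] by (rule set_integrable_norm)
  have avg0: "0 \<le> avg R (F R)"
    unfolding avg_def set_lebesgue_integral_def
    by (intro divide_nonneg_nonneg integral_nonneg_AE) (auto simp: F_def)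
  have \<gamma>1: "1 \<le> \<gamma>" by (rule projection_constant_ge_1[OF \<gamma> R])
  have Fm: "F R \<in> borel_measurable lebesgue" and F0: "\<And>x. 0 \<le> F R x" using gm by (auto simp: FR)
  have Fi': "set_integrable lebesgue (hcube a l) (F R)" using Fi unfolding al(2)[symmetric] .
  obtain \<D> where \<D>: "\<D> \<subseteq> hcubes" "half_packing lebesgue R \<D>"
    and out: "AE x in lebesgue. x \<in> R - \<Union>\<D> \<longrightarrow> F R x \<le> 2 * avg R (F R)"
    and avgD: "\<And>D. D \<in> \<D> \<Longrightarrow>
      (LINT x:D|lebesgue. F R x) \<le> 2 ^ CARD('n) * (2 * avg R (F R)) * measure lebesgue D"
    by (rule calderon_zygmund[OF al(1) Fm F0 Fi', folded al(2) avg_def]) blast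
  show ?thesis
  proof (intro exI[of _ \<D>] conjI ballI \<D>)
    have "1 * 1 \<le> 2 ^ CARD('n) * \<gamma>" using \<gamma>1 by (intro mult_mono) auto
    then have "1 * (2 * avg R (F R)) \<le> 2 ^ CARD('n) * \<gamma> * (2 * avg R (F R))"
      using avg0 by (intro mult_right_mono) auto
    then have le: "2 * avg R (F R) \<le> 2 * 2 ^ CARD('n) * \<gamma> * avg R (F R)" by (simp add: mult_ac)
    show "AE x in lebesgue. x \<in> R - \<Union>\<D> \<longrightarrow> F R x \<le> 2 * 2 ^ CARD('n) * \<gamma> * avg R (F R)"
      using out by eventually_elim (use le in \<open>auto intro: order_trans\<close>)
    fix D assume D: "D \<in> \<D>"
    then have DQ: "D \<in> hcubes" using \<D> by auto
    note DD = hcubesD[OF DQ]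
    \<comment> \<open>Subtracting a polynomial from \<open>f\<close> leaves the residual f - P_D f
      unchanged, so uniqueness identifies the projection of \<open>g\<close>.\<close>
    have "proj_poly k D g = (\<lambda>x. proj_poly k D f x - q x)"
    proof (rule proj_poly_eqI[OF DD(1-3) locally_integrable_bounded[OF g DD(1,2)]])
      show "(\<lambda>x. proj_poly k D f x - q x) \<in> polys_deg k"
        by (intro polys_deg_diff proj_poly_polys_deg_hcube DQ f q)
      show "(LINT x:D|lebesgue. (g x - (proj_poly k D f x - q x)) * complex_of_real (monom_n \<alpha> x)) = 0"
        if "\<alpha> \<in> multi_idx k" for \<alpha>
        using proj_poly_orthogonal[OF DD(1-3) locally_integrable_bounded[OF f DD(1,2)] that] by (simp add: g_def)
    qed
    then have "cmod (proj_poly k D f x - q x) \<le> \<gamma> * avg D (F R)" if "x \<in> D" for x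
      using proj_poly_bound_hcube[OF \<gamma> DQ g that] by (simp add: FR)
    moreover have "\<gamma> * avg D (F R) \<le> 2 * 2 ^ CARD('n) * \<gamma> * avg R (F R)"
    proof -
      have "avg D (F R) \<le> 2 ^ CARD('n) * (2 * avg R (F R))"
        using avgD[OF D] DD(5) by (simp add: avg_def divide_le_eq)
      then have "\<gamma> * avg D (F R) \<le> \<gamma> * (2 ^ CARD('n) * (2 * avg R (F R)))"
        using \<gamma>1 by (intro mult_left_mono) auto
      then show ?thesis by (simp add: mult_ac)
    qed
    moreover have "F R x \<le> cmod (proj_poly k D f x - q x) + F D x" for x
      using norm_triangle_ineq[of "proj_poly k D f x - q x" "f x - proj_poly k D f x"]
      by (simp add: F_def q_def)
    ultimately show "AE x in lebesgue. x \<in> D \<longrightarrow> F R x \<le> 2 * 2 ^ CARD('n) * \<gamma> * avg R (F R) + F D x"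
      by (intro AE_I2 impI) (meson add_right_mono order_trans)
  qed
qed

text \<open>Feeds half-open cubes into the abstract packing estimate, which wants A > 0; hence
  \<open>N\<close> is any strictly positive upper bound. The positivity statements are kept for the
  divisions and roots that follow.\<close>

lemma weighted_oscillation_nn_integral_le:
  fixes w :: "real^'n::finite \<Rightarrow> real" and f :: "real^'n \<Rightarrow> complex" and p r \<gamma> K N :: real
  assumes p: "1 < p" and r: "1 < r" and w: "\<And>x. 0 \<le> w x" "w \<in> borel_measurable lebesgue" "AE x in lebesgue. 0 < w x"
    and f: "locally_integrable f"
    and w_int: "\<And>C. is_cube C \<Longrightarrow> set_integrable lebesgue C (\<lambda>x. w x powr r)"
      "\<And>C. is_cube C \<Longrightarrow> set_integrable lebesgue C (\<lambda>x. w x powr (1 - conj_exp p))"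
    and K: "\<And>C. is_cube C \<Longrightarrow> (avg C (\<lambda>x. w x powr r)) powr (1 / r) *
      (avg C (\<lambda>x. w x powr (1 - conj_exp p))) powr (p - 1) \<le> K"
    and N: "\<And>C. is_cube C \<Longrightarrow> (1 / w_r r w C) * (LINT x:C|lebesgue. cmod (f x - proj_poly k C f x)) \<le> N" "0 < N"
    and \<gamma>: "\<And>(C::(real^'n) set) g x. is_cube C \<Longrightarrow> set_integrable lebesgue C g \<Longrightarrow> x \<in> C \<Longrightarrow>
      cmod (proj_poly k C g x) \<le> \<gamma> * avg C (\<lambda>y. cmod (g y))"
    and Q: "is_cube Q"
  shows "w_r r w Q > 0" "K > 0" "\<gamma> > 0"
    and "(\<integral>\<^sup>+x\<in>Q. ennreal (cmod (f x - proj_poly k Q f x) powr conj_exp p) * ennreal (w x powr (1 - conj_exp p)) \<partial>lebesgue)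
    \<le> ennreal ((8 * conj_exp p * (2 * 2 ^ CARD('n) * \<gamma> * N)) powr conj_exp p * K powr (conj_exp p - 1)
        * conj_exp r * w_r r w Q)"
proof -
  define q where "q = conj_exp p"
  define F where "F R x = cmod (f x - proj_poly k R f x)" for R x
  define \<sigma> where "\<sigma> x = w x powr (1 - q)" for x
  define v where "v x = w x powr r" for x
  have \<sigma>m: "\<sigma> \<in> borel_measurable lebesgue" and vm: "v \<in> borel_measurable lebesgue"
    unfolding \<sigma>_def[abs_def] v_def[abs_def] using w(2) by measurable
  have pos: "AE x in lebesgue. 0 < \<sigma> x" "AE x in lebesgue. 0 < v x"
    using w(3) by (eventually_elim, simp add: \<sigma>_def v_def)+
  have nn: "0 \<le> \<sigma> x" "0 \<le> v x" for x by (auto simp: \<sigma>_def v_def)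
  obtain Q' where Q': "closed_cube_of Q' Q" using is_cube_hcube[OF Q] by blast
  note Q'h = closed_cube_ofD(1)[OF Q']
  have \<gamma>1: "1 \<le> \<gamma>" by (rule projection_constant_ge_1[OF \<gamma> Q'h])
  then show "\<gamma> > 0" by simp
  have F0: "0 \<le> F R x" for R x by (simp add: F_def)
  have Fm: "F R \<in> borel_measurable lebesgue" if "R \<in> hcubes" for R
    unfolding F_def[abs_def]
    using locally_integrable_measurable[OF f] measurable_polys_deg[OF proj_poly_polys_deg_hcube[OF that f]]
    by measurable
  have ints: "set_integrable lebesgue R \<sigma>" "set_integrable lebesgue R v"
      "0 < (LINT x:R|lebesgue. \<sigma> x)" "0 < (LINT x:R|lebesgue. v x)" if R: "R \<in> hcubes" for R
  proof -
    obtain C where C: "closed_cube_of R C" using hcubes_closed_cube[OF R] by blast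
    note CD = closed_cube_ofD[OF C] and RD = hcubesD[OF R]
    show \<sigma>i: "set_integrable lebesgue R \<sigma>" and vi: "set_integrable lebesgue R v"
      using w_int[OF CD(2)] RD(2) CD(3) unfolding \<sigma>_def v_def q_def by (auto intro: set_integrable_subset)
    show "0 < (LINT x:R|lebesgue. \<sigma> x)" using \<sigma>i nn(1) pos(1) RD(2,5) by (rule set_integral_pos)
    show "0 < (LINT x:R|lebesgue. v x)" using vi nn(2) pos(2) RD(2,5) by (rule set_integral_pos)
  qed
  define a where "a R = ((LINT x:R|lebesgue. v x) / measure lebesgue R) powr (1 / r)" for R
  have wr: "w_r r w C = measure lebesgue R * a R" if C: "closed_cube_of R C" for R C
    unfolding w_r_def a_def using set_integral_closed_cube[OF C vm] measure_closed_cube[OF C]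
    by (simp add: avg_def v_def[abs_def])
  have apos: "0 < a R" if "R \<in> hcubes" for R
    using ints(4)[OF that] hcubesD(5)[OF that] by (simp add: a_def)
  show wrQ: "w_r r w Q > 0"
    using apos[OF Q'h] hcubesD(5)[OF Q'h] by (simp add: wr[OF Q'])
  have K': "a R * ((LINT x:R|lebesgue. \<sigma> x) / measure lebesgue R) powr (p - 1) \<le> K" if R: "R \<in> hcubes" for R
  proof -
    obtain C where C: "closed_cube_of R C" using hcubes_closed_cube[OF R] by blast
    from K[OF closed_cube_ofD(2)[OF C]] show ?thesis
      using set_integral_closed_cube[OF C vm] set_integral_closed_cube[OF C \<sigma>m]
        measure_closed_cube[OF C]
      by (simp add: avg_def v_def[abs_def] \<sigma>_def[abs_def] q_def a_def)
  qed
  have "0 < a Q' * ((LINT x:Q'|lebesgue. \<sigma> x) / measure lebesgue Q') powr (p - 1)"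
    using apos[OF Q'h] ints(3)[OF Q'h] hcubesD(5)[OF Q'h] by simp
  also have "\<dots> \<le> K" by (rule K'[OF Q'h])
  finally show "K > 0" .
  \<comment> \<open>Since w_r(R) = |R| a_R, the normalisation of the BMO norm turns into a bound for
    the plain average.\<close>
  have avgF: "avg R (F R) \<le> N * a R" if R: "R \<in> hcubes" for R
  proof -
    obtain C where C: "closed_cube_of R C" using hcubes_closed_cube[OF R] by blast
    have FC: "F C = F R" unfolding F_def[abs_def] proj_poly_closed_cube[OF C f] ..
    have "(1 / w_r r w C) * (LINT x:C|lebesgue. F C x) \<le> N"
      using N(1)[OF closed_cube_ofD(2)[OF C]] by (simp add: F_def)
    then have "(LINT x:R|lebesgue. F R x) \<le> N * (measure lebesgue R * a R)"
      using apos[OF R] hcubesD(5)[OF R]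
      by (simp add: FC set_integral_closed_cube[OF C Fm[OF R]] wr[OF C] divide_le_eq)
    then show ?thesis using hcubesD(5)[OF R] by (simp add: avg_def divide_le_eq mult_ac)
  qed
  define A where "A = 2 * 2 ^ CARD('n) * \<gamma> * N"
  have A: "A > 0" using \<gamma>1 N(2) by (simp add: A_def)
  have q: "q = p / (p - 1)" by (simp add: q_def conj_exp_def)
  have main: "(\<integral>\<^sup>+x\<in>Q'. ennreal (F Q' x powr q) * ennreal (\<sigma> x) \<partial>lebesgue)
    \<le> ennreal ((8 * q * A) powr q * K powr (q - 1) * (r / (r - 1)) * (measure lebesgue Q' * a Q'))"
    unfolding q a_def
  proof (rule nn_integral_powr_le_of_packing[where \<Q> = hcubes])
    show "\<exists>\<D>\<subseteq>hcubes. half_packing lebesgue R \<D>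
      \<and> (AE x in lebesgue. x \<in> R - \<Union>\<D> \<longrightarrow> F R x \<le> A * ((LINT x:R|lebesgue. v x) / measure lebesgue R) powr (1 / r))
      \<and> (\<forall>D\<in>\<D>. AE x in lebesgue. x \<in> D \<longrightarrow>
           F R x \<le> A * ((LINT x:R|lebesgue. v x) / measure lebesgue R) powr (1 / r) + F D x)"
      if R: "R \<in> hcubes" for R
    proof -
      have le: "2 * 2 ^ CARD('n) * \<gamma> * avg R (F R) \<le> A * a R"
        using mult_left_mono[OF avgF[OF R], of "2 * 2 ^ CARD('n) * \<gamma>"] \<gamma>1 by (simp add: A_def mult_ac)
      obtain \<D> where \<D>: "\<D> \<subseteq> hcubes" "half_packing lebesgue R \<D>"
        and out: "AE x in lebesgue. x \<in> R - \<Union>\<D> \<longrightarrow> F R x \<le> 2 * 2 ^ CARD('n) * \<gamma> * avg R (F R)"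
        and ins: "\<And>D. D \<in> \<D> \<Longrightarrow> AE x in lebesgue. x \<in> D \<longrightarrow> F R x \<le> 2 * 2 ^ CARD('n) * \<gamma> * avg R (F R) + F D x"
        using oscillation_packing[OF f \<gamma> R] unfolding F_def[abs_def] by blast
      have "AE x in lebesgue. x \<in> R - \<Union>\<D> \<longrightarrow> F R x \<le> A * a R"
        using out by (rule AE_mp) (use le in \<open>auto intro!: AE_I2 intro: order_trans\<close>)
      moreover have "AE x in lebesgue. x \<in> D \<longrightarrow> F R x \<le> A * a R + F D x" if "D \<in> \<D>" for D
        using ins[OF that] by (rule AE_mp) (use le in \<open>auto intro!: AE_I2\<close>)
      ultimately show ?thesis using \<D> unfolding a_def by blast
    qed
    show "((LINT x:R|lebesgue. v x) / measure lebesgue R) powr (1 / r) *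
      ((LINT x:R|lebesgue. \<sigma> x) / measure lebesgue R) powr (p - 1) \<le> K" if "R \<in> hcubes" for R
      using K'[OF that] by (simp add: a_def)
  qed (use hcubesD Fm \<sigma>m nn ints p r A Q'h F0 in auto)
  have FQ: "F Q = F Q'" unfolding F_def[abs_def] proj_poly_closed_cube[OF Q' f] ..
  have "(\<integral>\<^sup>+x\<in>Q. ennreal (F Q x powr q) * ennreal (\<sigma> x) \<partial>lebesgue)
      = (\<integral>\<^sup>+x\<in>Q'. ennreal (F Q' x powr q) * ennreal (\<sigma> x) \<partial>lebesgue)"
    unfolding FQ
  proof (intro nn_integral_cong_AE, use closed_cube_ofD(4)[OF Q'] in eventually_elim)
    case (elim x)
    then show ?case by (auto simp: indicator_def)
  qed
  with main show "(\<integral>\<^sup>+x\<in>Q. ennreal (cmod (f x - proj_poly k Q f x) powr conj_exp p) * ennreal (w x powr (1 - conj_exp p)) \<partial>lebesgue)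
    \<le> ennreal ((8 * conj_exp p * (2 * 2 ^ CARD('n) * \<gamma> * N)) powr conj_exp p * K powr (conj_exp p - 1)
        * conj_exp r * w_r r w Q)"
    unfolding wr[OF Q'] by (simp add: F_def \<sigma>_def q_def A_def conj_exp_def)
qed

lemma weighted_oscillation_le:
  fixes w :: "real^'n::finite \<Rightarrow> real" and f :: "real^'n \<Rightarrow> complex" and p r \<gamma> K N :: real
  assumes p: "1 < p" and r: "1 < r" and w: "\<And>x. 0 \<le> w x" "w \<in> borel_measurable lebesgue" "AE x in lebesgue. 0 < w x"
    and f: "locally_integrable f"
    and w_int: "\<And>C. is_cube C \<Longrightarrow> set_integrable lebesgue C (\<lambda>x. w x powr r)"
      "\<And>C. is_cube C \<Longrightarrow> set_integrable lebesgue C (\<lambda>x. w x powr (1 - conj_exp p))"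
    and K: "\<And>C. is_cube C \<Longrightarrow> (avg C (\<lambda>x. w x powr r)) powr (1 / r) *
      (avg C (\<lambda>x. w x powr (1 - conj_exp p))) powr (p - 1) \<le> K"
    and N: "\<And>C. is_cube C \<Longrightarrow> (1 / w_r r w C) * (LINT x:C|lebesgue. cmod (f x - proj_poly k C f x)) \<le> N" "0 < N"
    and \<gamma>: "\<And>(C::(real^'n) set) g x. is_cube C \<Longrightarrow> set_integrable lebesgue C g \<Longrightarrow> x \<in> C \<Longrightarrow>
      cmod (proj_poly k C g x) \<le> \<gamma> * avg C (\<lambda>y. cmod (g y))"
    and Q: "is_cube Q"
  defines "h \<equiv> \<lambda>x. (cmod (f x - proj_poly k Q f x) / w x) powr (conj_exp p) * w x"
  shows "set_integrable lebesgue Q h"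
    and "((1 / w_r r w Q) * (LINT x:Q|lebesgue. h x)) powr (1 / conj_exp p)
      \<le> (16 * 2 ^ CARD('n)) * \<gamma> * conj_exp p * K powr (1 / p) * conj_exp r powr (1 / conj_exp p) * N"
proof -
  note main = weighted_oscillation_nn_integral_le[OF p r w f w_int K N \<gamma> Q]
  define q where "q = conj_exp p"
  \<comment> \<open>The second identity turns K^(q-1) into K^(1/p) under the q-th root.\<close>
  have q: "1 < q" "(q - 1) * (1 / q) = 1 / p" using p by (auto simp: q_def conj_exp_def field_simps)
  have r': "0 < conj_exp r" using r by (simp add: conj_exp_def)
  \<comment> \<open>The 16 is 8 from the iteration times 2 from the Calderon--Zygmund threshold; 2^n
    is the loss in passing to a parent cube.\<close>
  define A where "A = 16 * 2 ^ CARD('n) * q * \<gamma> * N"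
  have A: "A > 0" using q main(3) N(2) by (simp add: A_def)
  define T where "T = A powr q * K powr (q - 1) * conj_exp r"
  have T: "T \<ge> 0" using r' by (simp add: T_def)
  obtain Q' where Q': "closed_cube_of Q' Q" using is_cube_hcube[OF Q] by blast
  have P: "proj_poly k Q f \<in> borel_measurable lebesgue"
    using measurable_polys_deg[OF proj_poly_polys_deg_hcube[OF closed_cube_ofD(1)[OF Q'] f]]
    unfolding proj_poly_closed_cube[OF Q' f] .
  have hm: "h \<in> borel_measurable lebesgue"
    unfolding h_def using P w(2) locally_integrable_measurable[OF f] by measurable
  have Qm: "Q \<in> sets lebesgue" using closed_cube_ofD(6)[OF Q'] .
  have h0: "0 \<le> h x" for x using w(1) by (simp add: h_def)
  have "(\<integral>\<^sup>+x. ennreal (indicator Q x *\<^sub>R h x) \<partial>lebesgue)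
      = (\<integral>\<^sup>+x\<in>Q. ennreal (cmod (f x - proj_poly k Q f x) powr conj_exp p) * ennreal (w x powr (1 - conj_exp p)) \<partial>lebesgue)"
  proof (intro nn_integral_cong_AE, use w(3) in eventually_elim)
    case (elim x)
    \<comment> \<open>Where w > 0, (F/w)^q w = F^q w^(1-q); this identifies the stated integrand
      with F^q \<sigma>.\<close>
    have "h x = cmod (f x - proj_poly k Q f x) powr conj_exp p * w x powr (1 - conj_exp p)"
      using elim by (simp add: h_def powr_divide powr_diff)
    then show ?case by (simp add: indicator_def ennreal_mult'[symmetric])
  qed
  also have "\<dots> \<le> ennreal (T * w_r r w Q)"
    using main(4) by (simp add: T_def A_def q_def mult_ac)
  finally have le: "(\<integral>\<^sup>+x. ennreal (indicator Q x *\<^sub>R h x) \<partial>lebesgue) \<le> ennreal (T * w_r r w Q)" .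
  have "integrable lebesgue (\<lambda>x. indicator Q x *\<^sub>R h x)"
  proof (rule integrableI_nonneg)
    show "(\<lambda>x. indicator Q x *\<^sub>R h x) \<in> borel_measurable lebesgue" using hm Qm by measurable
    show "AE x in lebesgue. 0 \<le> indicator Q x *\<^sub>R h x" using h0 by auto
    show "(\<integral>\<^sup>+x. ennreal (indicator Q x *\<^sub>R h x) \<partial>lebesgue) < \<infinity>"
      using le by (rule order_le_less_trans) simp
  qed
  then show "set_integrable lebesgue Q h" by (simp add: set_integrable_def)
  have "(LINT x:Q|lebesgue. h x) \<le> T * w_r r w Q"
    unfolding set_lebesgue_integral_def
  proof (rule integral_real_bounded)
    show "0 \<le> T * w_r r w Q" using T main(1) by simp
  qed (rule le)
  then have "(1 / w_r r w Q) * (LINT x:Q|lebesgue. h x) \<le> T" using main(1) by (simp add: divide_le_eq)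
  moreover have "0 \<le> (1 / w_r r w Q) * (LINT x:Q|lebesgue. h x)"
    unfolding set_lebesgue_integral_def using main(1) h0
    by (intro mult_nonneg_nonneg integral_nonneg_AE) auto
  ultimately have "((1 / w_r r w Q) * (LINT x:Q|lebesgue. h x)) powr (1 / q) \<le> T powr (1 / q)"
    using q by (intro powr_mono2) auto
  also have "T powr (1 / q) = A * K powr (1 / p) * conj_exp r powr (1 / q)"
    unfolding T_def using A main(2) r' q by (simp add: powr_mult powr_powr)
  finally show "((1 / w_r r w Q) * (LINT x:Q|lebesgue. h x)) powr (1 / conj_exp p)
      \<le> (16 * 2 ^ CARD('n)) * \<gamma> * conj_exp p * K powr (1 / p) * conj_exp r powr (1 / conj_exp p) * N"
    by (simp add: A_def q_def mult_ac)
qed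

theorem theorem7p2:
  "\<exists>c::real. c > 0 \<and>
    (\<forall>(k::nat) (p::real) (r::real) (w::real^'n::finite \<Rightarrow> real) (f::real^'n \<Rightarrow> complex) (\<gamma>::real) Q.
      1 < p \<longrightarrow> 1 < r \<longrightarrow>
      (\<forall>x. 0 \<le> w x) \<longrightarrow> locally_integrable w \<longrightarrow>
      locally_integrable f \<longrightarrow>
      \<comment> \<open>[w]_{A_p^r} < \<infinity>\<close>
      (AE x in lebesgue. 0 < w x) \<longrightarrow>
      (\<forall>Q. is_cube Q \<longrightarrow> set_integrable lebesgue Q (\<lambda>x. w x powr r)
                       \<and> set_integrable lebesgue Q (\<lambda>x. w x powr (1 - conj_exp p))) \<longrightarrow>
      bdd_above (Apr_set p r w) \<longrightarrow>
      \<comment> \<open>\<parallel>f\<parallel>_{BMO_k^r(w)} < \<infinity>\<close>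
      bdd_above (BMO_set k r w f) \<longrightarrow>
      \<comment> \<open>\<gamma> is a constant with |P_R g(x)| \<le> \<gamma> avg_R |g|\<close>
      (\<forall>(R::(real^'n) set) g x. is_cube R \<longrightarrow> set_integrable lebesgue R g \<longrightarrow> x \<in> R \<longrightarrow>
          cmod (proj_poly k R g x) \<le> \<gamma> * avg R (\<lambda>y. cmod (g y))) \<longrightarrow>
      is_cube Q \<longrightarrow>
      set_integrable lebesgue Q
        (\<lambda>x. (cmod (f x - proj_poly k Q f x) / w x) powr (conj_exp p) * w x) \<and>
      ((1 / w_r r w Q) * (LINT x:Q|lebesgue. (cmod (f x - proj_poly k Q f x) / w x) powr (conj_exp p) * w x))
          powr (1 / conj_exp p)
        \<le> c * \<gamma> * conj_exp p * Apr_const p r w powr (1 / p) * conj_exp r powr (1 / conj_exp p)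
            * BMO_norm k r w f)"
proof (intro exI[of _ "16 * 2 ^ CARD('n)"] conjI[of "_ > _"] allI impI)
  show "(16 * 2 ^ CARD('n) :: real) > 0" by simp
next
  fix k :: nat and p r \<gamma> :: real and w :: "real^'n \<Rightarrow> real" and f :: "real^'n \<Rightarrow> complex" and Q :: "(real^'n) set"
  assume p: "1 < p" and r: "1 < r" and w0: "\<forall>x. 0 \<le> w x" and w_loc: "locally_integrable w"
    and f: "locally_integrable f" and w_pos: "AE x in lebesgue. 0 < w x"
    and w_int: "\<forall>Q. is_cube Q \<longrightarrow> set_integrable lebesgue Q (\<lambda>x. w x powr r)
      \<and> set_integrable lebesgue Q (\<lambda>x. w x powr (1 - conj_exp p))"
    and Apr: "bdd_above (Apr_set p r w)" and BMO: "bdd_above (BMO_set k r w f)"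
    and \<gamma>: "\<forall>(R::(real^'n) set) g x. is_cube R \<longrightarrow> set_integrable lebesgue R g \<longrightarrow> x \<in> R \<longrightarrow>
          cmod (proj_poly k R g x) \<le> \<gamma> * avg R (\<lambda>y. cmod (g y))"
    and Q: "is_cube Q"
  let ?h = "\<lambda>x. (cmod (f x - proj_poly k Q f x) / w x) powr (conj_exp p) * w x"
  let ?K = "Apr_const p r w" and ?N = "BMO_norm k r w f"
  let ?lhs = "((1 / w_r r w Q) * (LINT x:Q|lebesgue. ?h x)) powr (1 / conj_exp p)"
  let ?C = "(16 * 2 ^ CARD('n)) * \<gamma> * conj_exp p * ?K powr (1 / p) * conj_exp r powr (1 / conj_exp p)"
  have wm: "w \<in> borel_measurable lebesgue" by (rule locally_integrable_measurable[OF w_loc])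
  have K: "(avg C (\<lambda>x. w x powr r)) powr (1 / r) *
      (avg C (\<lambda>x. w x powr (1 - conj_exp p))) powr (p - 1) \<le> ?K" if "is_cube C" for C
    unfolding Apr_const_def using that by (intro cSup_upper Apr) (auto simp: Apr_set_def)
  have N: "(1 / w_r r w C) * (LINT x:C|lebesgue. cmod (f x - proj_poly k C f x)) \<le> ?N" if "is_cube C" for C
    unfolding BMO_norm_def using that by (intro cSup_upper BMO) (auto simp: BMO_set_def)
  have "0 \<le> (1 / w_r r w Q) * (LINT x:Q|lebesgue. cmod (f x - proj_poly k Q f x))"
    unfolding set_lebesgue_integral_def w_r_def
    by (intro mult_nonneg_nonneg integral_nonneg_AE) auto
  also have "\<dots> \<le> ?N" by (rule N[OF Q])
  finally have N0: "0 \<le> ?N" .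
  have w0': "0 \<le> w x" for x using w0 by blast
  have w_int': "set_integrable lebesgue C (\<lambda>x. w x powr r)"
      "set_integrable lebesgue C (\<lambda>x. w x powr (1 - conj_exp p))" if "is_cube C" for C
    using w_int that by blast+
  have \<gamma>': "cmod (proj_poly k C g x) \<le> \<gamma> * avg C (\<lambda>y. cmod (g y))"
    if "is_cube C" "set_integrable lebesgue C g" "x \<in> C" for C :: "(real^'n) set" and g x
    using \<gamma> that by blast
  have N_le: "(1 / w_r r w C) * (LINT x:C|lebesgue. cmod (f x - proj_poly k C f x)) \<le> N'"
    if "?N < N'" "is_cube C" for N' C
    using N[OF that(2)] that(1) by linarith
  \<comment> \<open>The norm may be zero, whereas the estimate wants a positive bound. It is
    therefore applied to every \<open>N'\<close> above the norm, and \<open>N'\<close> is then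
    lowered to the norm.\<close>
  have bound: "set_integrable lebesgue Q ?h" "?lhs \<le> ?C * N'" if N': "?N < N'" for N'
  proof -
    have "0 < N'" using N0 N' by linarith
    note weighted_oscillation_le[OF p r w0' wm w_pos f w_int' K N_le[OF N'] this \<gamma>' Q]
    then show "set_integrable lebesgue Q ?h" "?lhs \<le> ?C * N'" by blast+
  qed
  have "?N < ?N + 1" "0 < ?N + 1" using N0 by auto
  note pos = weighted_oscillation_nn_integral_le(2,3)[OF p r w0' wm w_pos f w_int' K
    N_le[OF this(1)] this(2) \<gamma>' Q]
  have C: "?C > 0" using pos p r by (simp add: conj_exp_def)
  have "?lhs / ?C \<le> ?N"
  proof (rule dense_ge)
    fix N' assume "?N < N'"
    from bound(2)[OF this] show "?lhs / ?C \<le> N'" using C by (simp only: pos_divide_le_eq mult.commute)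
  qed
  then have "?lhs \<le> ?C * ?N" using C by (simp only: pos_divide_le_eq mult.commute)
  then show "set_integrable lebesgue Q ?h \<and> ?lhs \<le> ?C * ?N" using bound(1)[of "?N + 1"] by simp
qed

end
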